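(* In the EH-CCRN model described in the context, with all parameters other than the energy-harvesting parameter $\rho$ held fixed, the throughput $\tau=\tfrac12 R_s\,\zeta\,(1-p)$ is a concave function of $\rho\in(0,1)$, both for the power-splitting (PS-EH) and for the time-switching (TS-EH) protocol.
   Context: Random channel model. Let $L\ge 1$ be an integer (number of relay antennas) and let $\lambda_{sr},\lambda_{rd},\lambda_{sd},\lambda_{sp},\lambda_{rp}>0$. The following random variables are mutually independent complex circular Gaussians: $h^i_{sr}\sim\mathcal{CN}(0,\lambda_{sr}^{-1})$ ($i=1,\dots,L$), $h^j_{rd}\sim\mathcal{CN}(0,\lambda_{rd}^{-1})$ and $g^j_{rp}\sim\mathcal{CN}(0,\lambda_{rp}^{-1})$ ($j=1,\dots,L$), $h_{sd}\sim\mathcal{CN}(0,\lambda_{sd}^{-1})$, $g_{sp}\sim\mathcal{CN}(0,\lambda_{sp}^{-1})$. Thus the squared moduli are independent exponentials with rates $\lambda_{sr},\lambda_{rd},\lambda_{rp},\lambda_{sd},\lambda_{sp}$, respectively. Put $\|\bm h_{sr}\|^2=\sum_{i=1}^L|h^i_{sr}|^2$. Constants: interference limit $I>0$, noise power $N_o>0$, harvesting efficiency $\eta\in(0,1]$, target rate $R_s>0$, threshold $\gamma_{th}=2^{2R_s}-1$. The energy-harvesting parameter is $\rho\in(0,1)$. Protocol-dependent parameters: for PS-EH, $\xi=1-\rho$, $\beta=\eta\rho$, $\zeta=1$; for TS-EH, $\xi=1$, $\beta=\frac{2\eta\rho}{1-\rho}$, $\zeta=1-\rho$. Source power: $P_s=I/|g_{sp}|^2$.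 SNRs: $$\Gamma_r=\frac{\xi P_s\|\bm h_{sr}\|^2}{N_o},\qquad \Gamma_{d_1}=\frac{P_s|h_{sd}|^2}{N_o},\qquad \Gamma_d^{j}=\frac{1}{N_o}\min\Big(\beta P_s\|\bm h_{sr}\|^2,\frac{I}{|g^j_{rp}|^2}\Big)|h^j_{rd}|^2+\Gamma_{d_1}.$$ The selected relay antenna is $\hat j=\arg\max_j\Gamma_d^j$. The outage probability is $p=\Pr[\min(\Gamma_r,\Gamma_d^{\hat j})<\gamma_{th}]$. *)

theory Defs
  imports "HOL-Probability.Probability"
begin

text \<open>Energy-harvesting cooperative cognitive radio network with an \<open>L\<close>-antenna relay. The
  antennas are numbered \<open>1, \<dots>, L\<close>. All channel coefficients are collected in one family indexed
  by the following type, so that their mutual independence is a single \<open>indep_vars\<close> statement.\<close>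

datatype link =
    SR nat  \<comment> \<open>source to relay antenna \<open>i\<close>\<close>
  | RD nat  \<comment> \<open>relay antenna \<open>j\<close> to destination\<close>
  | RP nat  \<comment> \<open>relay antenna \<open>j\<close> to primary receiver (interference)\<close>
  | SD      \<comment> \<open>source to destination\<close>
  | SP      \<comment> \<open>source to primary receiver (interference)\<close>

definition links :: "nat \<Rightarrow> link set" where
  "links L = SR ` {1..L} \<union> RD ` {1..L} \<union> RP ` {1..L} \<union> {SD, SP}"

fun link_rate :: "real \<Rightarrow> real \<Rightarrow> real \<Rightarrow> real \<Rightarrow> real \<Rightarrow> link \<Rightarrow> real" where
  "link_rate lam_sr lam_rd lam_sd lam_sp lam_rp (SR i) = lam_sr"
| "link_rate lam_sr lam_rd lam_sd lam_sp lam_rp (RD j) = lam_rd"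
| "link_rate lam_sr lam_rd lam_sd lam_sp lam_rp (RP j) = lam_rp"
| "link_rate lam_sr lam_rd lam_sd lam_sp lam_rp SD = lam_sd"
| "link_rate lam_sr lam_rd lam_sd lam_sp lam_rp SP = lam_sp"

text \<open>\<open>X\<close> has law \<open>CN(0, v)\<close>. Here \<open>v\<close> is the total variance \<open>E |X|\<^sup>2\<close>, so that the real and the
  imaginary part each have variance \<open>v / 2\<close>.\<close>

definition circular_gaussian :: "'w measure \<Rightarrow> ('w \<Rightarrow> complex) \<Rightarrow> real \<Rightarrow> bool" where
  "circular_gaussian M X v \<longleftrightarrow>
     distributed M lborel X (\<lambda>z. ennreal (exp (- (cmod z)\<^sup>2 / v) / (pi * v)))"

datatype protocol =
    PS_EH  \<comment> \<open>power splitting\<close>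
  | TS_EH  \<comment> \<open>time switching\<close>

fun \<xi> :: "protocol \<Rightarrow> real \<Rightarrow> real" where
  "\<xi> PS_EH \<rho> = 1 - \<rho>"
| "\<xi> TS_EH \<rho> = 1"

fun \<beta> :: "protocol \<Rightarrow> real \<Rightarrow> real \<Rightarrow> real" where
  "\<beta> PS_EH \<eta> \<rho> = \<eta> * \<rho>"
| "\<beta> TS_EH \<eta> \<rho> = 2 * \<eta> * \<rho> / (1 - \<rho>)"

fun \<zeta> :: "protocol \<Rightarrow> real \<Rightarrow> real" where
  "\<zeta> PS_EH \<rho> = 1"
| "\<zeta> TS_EH \<rho> = 1 - \<rho>"

text \<open>Below, \<open>h\<close> is the family of channel coefficients (including the interference channels),
  \<open>Ip\<close> the interference limit and \<open>No\<close> the noise power. The quotients by \<open>|h SP|\<^sup>2\<close> and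
  \<open>|h (RP j)|\<^sup>2\<close> take the junk value 0 where the denominator vanishes, which is a null event.\<close>

definition threshold :: "real \<Rightarrow> real" where
  "threshold Rs = 2 powr (2 * Rs) - 1"

definition source_power :: "real \<Rightarrow> (link \<Rightarrow> 'w \<Rightarrow> complex) \<Rightarrow> 'w \<Rightarrow> real" where
  "source_power Ip h \<omega> = Ip / (cmod (h SP \<omega>))\<^sup>2"

definition sr_gain :: "nat \<Rightarrow> (link \<Rightarrow> 'w \<Rightarrow> complex) \<Rightarrow> 'w \<Rightarrow> real" where
  "sr_gain L h \<omega> = (\<Sum>i\<in>{1..L}. (cmod (h (SR i) \<omega>))\<^sup>2)"

definition snr_relay ::
    "nat \<Rightarrow> (link \<Rightarrow> 'w \<Rightarrow> complex) \<Rightarrow> real \<Rightarrow> real \<Rightarrow> protocol \<Rightarrow> real \<Rightarrow> 'w \<Rightarrow> real" where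
  "snr_relay L h Ip No prot \<rho> \<omega> =
     \<xi> prot \<rho> * source_power Ip h \<omega> * sr_gain L h \<omega> / No"

definition snr_direct :: "(link \<Rightarrow> 'w \<Rightarrow> complex) \<Rightarrow> real \<Rightarrow> real \<Rightarrow> 'w \<Rightarrow> real" where
  "snr_direct h Ip No \<omega> = source_power Ip h \<omega> * (cmod (h SD \<omega>))\<^sup>2 / No"

definition snr_dest ::
    "nat \<Rightarrow> (link \<Rightarrow> 'w \<Rightarrow> complex) \<Rightarrow> real \<Rightarrow> real \<Rightarrow> real \<Rightarrow> protocol \<Rightarrow> real \<Rightarrow> nat \<Rightarrow> 'w \<Rightarrow> real" where
  "snr_dest L h Ip No \<eta> prot \<rho> j \<omega> =
     1 / No * min (\<beta> prot \<eta> \<rho> * source_power Ip h \<omega> * sr_gain L h \<omega>)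
                  (Ip / (cmod (h (RP j) \<omega>))\<^sup>2) * (cmod (h (RD j) \<omega>))\<^sup>2
     + snr_direct h Ip No \<omega>"

text \<open>Ties are broken arbitrarily by \<open>arg_max_on\<close>; the SNR of the selected antenna does not
  depend on how.\<close>

definition selected_antenna ::
    "nat \<Rightarrow> (link \<Rightarrow> 'w \<Rightarrow> complex) \<Rightarrow> real \<Rightarrow> real \<Rightarrow> real \<Rightarrow> protocol \<Rightarrow> real \<Rightarrow> 'w \<Rightarrow> nat" where
  "selected_antenna L h Ip No \<eta> prot \<rho> \<omega> =
     arg_max_on (\<lambda>j. snr_dest L h Ip No \<eta> prot \<rho> j \<omega>) {1..L}"

definition outage_prob ::
    "'w measure \<Rightarrow> nat \<Rightarrow> (link \<Rightarrow> 'w \<Rightarrow> complex) \<Rightarrow> real \<Rightarrow> real \<Rightarrow> real \<Rightarrow> real \<Rightarrow>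
     protocol \<Rightarrow> real \<Rightarrow> real" where
  "outage_prob M L h Ip No \<eta> Rs prot \<rho> =
     \<P>(\<omega> in M. min (snr_relay L h Ip No prot \<rho> \<omega>)
                  (snr_dest L h Ip No \<eta> prot \<rho> (selected_antenna L h Ip No \<eta> prot \<rho> \<omega>) \<omega>)
              < threshold Rs)"

definition throughput ::
    "'w measure \<Rightarrow> nat \<Rightarrow> (link \<Rightarrow> 'w \<Rightarrow> complex) \<Rightarrow> real \<Rightarrow> real \<Rightarrow> real \<Rightarrow> real \<Rightarrow>
     protocol \<Rightarrow> real \<Rightarrow> real" where
  "throughput M L h Ip No \<eta> Rs prot \<rho> =
     1 / 2 * Rs * \<zeta> prot \<rho> * (1 - outage_prob M L h Ip No \<eta> Rs prot \<rho>)"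

end

(*
  The exponential variable |g_sp|^2 has the concave distribution function F(x) = 1 - exp(-l x), so the
  success probability is concave in (xi, beta) as soon as, conditionally on the other source gains, the
  success level of the relay links is a quasiconcave function of (|g_sp|^2, xi, beta): the superlevel
  sets have sections {x <= w} with w concave in (xi, beta), and by the layer cake formula the success
  probability is an average of the functions F(w).

  Given the source gains, a single relay antenna succeeds with probability
  Q(p, z) = exp(-p) (1 - p / (p + z) exp(-z)), where p and z are affine in (|g_sp|^2 / beta, 1 / beta).
  The projective map behind this substitution preserves segments, hence quasiconcavity, so it suffices
  that Q is quasiconcave; taking the best of L conditionally independent antennas preserves the level
  sets.  Quasiconcavity of Q is the second-order criterion: every critical point of Q on a segment is
  a strict local maximum.

  For PS-EH the pair (xi, beta) is affine in rho.  For TS-EH the factor 1 - rho makes the throughput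
  the perspective of a concave function of beta.
*)

theory Submission
  imports Defs "HOL-Real_Asymp.Real_Asymp"
begin

section \<open>Quasiconcavity of the single-antenna success probability\<close>

lemma convex_combination_pos:
  fixes a b t :: real
  assumes "0 < a" "0 < b" "0 \<le> t" "t \<le> 1"
  shows "0 < (1 - t) * a + t * b"
proof (cases "t = 0")
  case False
  then show ?thesis using assms by (intro add_nonneg_pos) auto
qed (use assms in simp)

text \<open>If the minimum of \<open>f\<close> over the segment were below both end values, it would
  be attained at an interior \<open>m\<close>, where \<open>g m = 0\<close>. There \<open>g\<close>
  passes from positive to negative, so \<open>f\<close> strictly decreases just to the right of
  \<open>m\<close>, a contradiction. Splitting the derivative as \<open>c * g\<close> means that
  only the factor carrying the sign has to be differentiated again.\<close>

lemma ge_min_endpoints_if_critical_decreasing: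
  fixes f g g' c :: "real \<Rightarrow> real"
  assumes f: "\<And>t. 0 \<le> t \<Longrightarrow> t \<le> 1 \<Longrightarrow> (f has_real_derivative c t * g t) (at t)"
    and c: "\<And>t. 0 \<le> t \<Longrightarrow> t \<le> 1 \<Longrightarrow> c t > 0"
    and g: "\<And>t. 0 \<le> t \<Longrightarrow> t \<le> 1 \<Longrightarrow> (g has_real_derivative g' t) (at t)"
    and crit: "\<And>t. 0 \<le> t \<Longrightarrow> t \<le> 1 \<Longrightarrow> g t = 0 \<Longrightarrow> g' t < 0"
    and t: "0 \<le> t" "t \<le> 1"
  shows "min (f 0) (f 1) \<le> f t"
proof -
  have cont: "continuous_on {0..1} f"
    using f by (intro continuous_at_imp_continuous_on ballI DERIV_isCont) auto
  obtain m where m: "m \<in> {0..1}" "\<And>y. y \<in> {0..1} \<Longrightarrow> f m \<le> f y"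
    using continuous_attains_inf[OF _ _ cont] by auto
  have "min (f 0) (f 1) \<le> f m"
  proof (rule ccontr)
    assume "\<not> ?thesis"
    then have m01: "0 < m" "m < 1"
      using m(1) by (auto simp: less_le)
    have "c m * g m = 0"
    proof (rule DERIV_local_min)
      show "(f has_real_derivative c m * g m) (at m)" using f m01 by simp
      show "0 < min m (1 - m)" using m01 by simp
      show "\<forall>y. \<bar>m - y\<bar> < min m (1 - m) \<longrightarrow> f m \<le> f y"
        by (auto intro!: m(2))
    qed
    then have g0: "g m = 0" using c[of m] m01 by auto
    obtain d where d: "d > 0" "\<And>h. h > 0 \<Longrightarrow> h < d \<Longrightarrow> g (m + h) < 0"
      using DERIV_neg_dec_right[OF g crit, of m] g0 m01 by auto
    define h where "h = min (d / 2) (1 - m)"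
    have h: "0 < h" "h < d" "m + h \<le> 1" using d m01 by (auto simp: h_def)
    have "f (m + h) < f m"
    proof (rule DERIV_neg_imp_decreasing_open[where f = f and a = m and b = "m + h"])
      fix x assume x: "m < x" "x < m + h"
      then have "g x < 0" using d(2)[of "x - m"] h by simp
      then show "\<exists>y. (f has_real_derivative y) (at x) \<and> y < 0"
        using f[of x] c[of x] x h m01 by (intro exI[of _ "c x * g x"]) (auto simp: mult_pos_neg)
    next
      show "continuous_on {m..m + h} f"
        using cont by (rule continuous_on_subset) (use h m01 in auto)
    qed (use h in simp)
    with m(2)[of "m + h"] h m01 show False by simp
  qed
  with m(2)[of t] t show ?thesis by simp
qed

text \<open>For independent exponential \<open>R\<close>, \<open>G\<close> of rates \<open>\<mu>\<close>, \<open>\<nu>\<close> and \<open>c, x > 0\<close>, this is the probability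
  that \<open>T \<le> c * R\<close> and \<open>T * G \<le> x * R\<close>, where \<open>p = \<mu> * T / c\<close> and \<open>z = \<nu> * x / c\<close>.\<close>

definition link_prob :: "real \<Rightarrow> real \<Rightarrow> real" where
  "link_prob p z = (if p \<le> 0 then 1 else exp (- p) * (1 - p / (p + z) * exp (- z)))"

text \<open>The criterion above is applied to the restriction \<open>f\<close> of
  \<open>link_prob\<close> to the segment. A segment reduced to a point is split off first: there
  \<open>g\<close> and its derivative both vanish, while the criterion asks for a strictly negative
  derivative.\<close>

lemma link_prob_quasiconcave_pos:
  fixes x1 z1 x2 z2 :: real
  assumes pos: "x1 > 0" "z1 > 0" "x2 > 0" "z2 > 0" and t: "0 \<le> t" "t \<le> 1"
  shows "min (link_prob x1 z1) (link_prob x2 z2) \<le> link_prob ((1 - t) * x1 + t * x2) ((1 - t) * z1 + t * z2)"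
proof (cases "x1 = x2 \<and> z1 = z2")
  case True
  then show ?thesis by (simp add: algebra_simps)
next
  case False
  define u w where "u = x2 - x1" and "w = z2 - z1"
  define x z s E where "x = (\<lambda>t. x1 + t * u)" and "z = (\<lambda>t. z1 + t * w)"
    and "s = (\<lambda>t. x t + z t)" and "E = (\<lambda>t. exp (z t))"
  \<comment> \<open>The gradient of \<open>link_prob\<close> is a positive multiple of \<open>(- A, B)\<close>.\<close>
  define A where "A = (\<lambda>t. (s t)\<^sup>2 * E t + z t - x t * s t)"
  define B where "B = (\<lambda>t. x t * (s t + 1))"
  define g where "g = (\<lambda>t. B t * w - A t * u)"
  define Ax Az Bx Bz where "Ax = (\<lambda>t. 2 * s t * E t - s t - x t)"
    and "Az = (\<lambda>t. 2 * s t * E t + (s t)\<^sup>2 * E t + 1 - x t)"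
    and "Bx = (\<lambda>t. s t + 1 + x t)" and "Bz = x"
  define g' where "g' = (\<lambda>t. (Bx t * u + Bz t * w) * w - (Ax t * u + Az t * w) * u)"
  define f where "f = (\<lambda>t. exp (- x t) * (1 - x t / s t * exp (- z t)))"
  have xeq: "x t = (1 - t) * x1 + t * x2" and zeq: "z t = (1 - t) * z1 + t * z2" for t
    by (simp_all add: x_def z_def u_def w_def algebra_simps)
  have xpos: "x t > 0" and zpos: "z t > 0" if "0 \<le> t" "t \<le> 1" for t
    unfolding xeq zeq using pos that by (simp_all add: convex_combination_pos)
  have fQ: "f t = link_prob ((1 - t) * x1 + t * x2) ((1 - t) * z1 + t * z2)" if "0 \<le> t" "t \<le> 1" for t
    using xpos[OF that] by (simp add: f_def link_prob_def s_def xeq zeq)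
  have "min (f 0) (f 1) \<le> f t"
  proof (rule ge_min_endpoints_if_critical_decreasing[where c = "\<lambda>t. exp (- x t - z t) / (s t)\<^sup>2"
        and g = g and g' = g'])
    fix t :: real assume t: "0 \<le> t" "t \<le> 1"
    have X: "x t > 0" "z t > 0" "s t > 0" using xpos[OF t] zpos[OF t] by (auto simp: s_def)
    show "exp (- x t - z t) / (s t)\<^sup>2 > 0" using X by simp
    have Dx: "(x has_real_derivative u) (at t)" and Dz: "(z has_real_derivative w) (at t)"
      unfolding x_def z_def by (auto intro!: derivative_eq_intros)
    have Ds: "(s has_real_derivative u + w) (at t)"
      unfolding s_def by (intro derivative_intros Dx Dz)
    have DE: "(E has_real_derivative E t * w) (at t)"
      unfolding E_def by (auto intro!: derivative_eq_intros Dz)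
    show "(g has_real_derivative g' t) (at t)"
      unfolding g_def g'_def A_def B_def Ax_def Az_def Bx_def Bz_def
      by (rule derivative_eq_intros Dx Dz Ds DE refl)+ (simp add: algebra_simps power2_eq_square)
    have e: "exp (- z t) = 1 / E t" "exp (- x t - z t) = exp (- x t) / E t"
      by (simp_all add: E_def exp_minus exp_diff field_simps)
    have Et: "E t > 0" by (simp add: E_def)
    show "(f has_real_derivative exp (- x t - z t) / (s t)\<^sup>2 * g t) (at t)"
    proof -
      have D1: "((\<lambda>t. exp (- x t)) has_real_derivative - (exp (- x t) * u)) (at t)"
        by (auto intro!: derivative_eq_intros Dx)
      have D2: "((\<lambda>t. exp (- z t)) has_real_derivative - (exp (- z t) * w)) (at t)"
        by (auto intro!: derivative_eq_intros Dz)
      have D3: "((\<lambda>t. x t / s t) has_real_derivative (u * s t - x t * (u + w)) / (s t * s t)) (at t)"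
        using X by (intro DERIV_divide Dx Ds) auto
      have "(f has_real_derivative
          exp (- x t) * (0 - (x t / s t * (- (exp (- z t) * w))
            + (u * s t - x t * (u + w)) / (s t * s t) * exp (- z t)))
          + - (exp (- x t) * u) * (1 - x t / s t * exp (- z t))) (at t)"
        unfolding f_def by (intro DERIV_mult' DERIV_diff DERIV_const D1 D2 D3)
      also have "exp (- x t) * (0 - (x t / s t * (- (exp (- z t) * w))
            + (u * s t - x t * (u + w)) / (s t * s t) * exp (- z t)))
          + - (exp (- x t) * u) * (1 - x t / s t * exp (- z t))
          = exp (- x t - z t) / (s t)\<^sup>2 * g t"
        unfolding e g_def A_def B_def using X Et
        apply (simp add: divide_simps power2_eq_square)
        apply (simp add: s_def algebra_simps power2_eq_square)
        done
      finally show ?thesis .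
    qed
    assume g0: "g t = 0"
    have Bpos: "B t > 0" using X by (simp add: B_def)
    have BA: "B t * w = A t * u" using g0 by (simp add: g_def)
    \<comment> \<open>Because \<open>B t > 0\<close>, a critical point with \<open>u = 0\<close>
      would force \<open>w = 0\<close>, the excluded degenerate segment.\<close>
    have u0: "u \<noteq> 0"
    proof
      assume "u = 0"
      with BA Bpos have "w = 0" by simp
      with \<open>u = 0\<close> False show False by (simp add: u_def w_def)
    qed
    \<comment> \<open>\<open>P\<close> is the bordered Hessian with the factor
      \<open>x t * (s t)\<^sup>2\<close> taken out, arranged so that \<open>E t > 1\<close> makes
      both summands positive. The factorization checked below is a polynomial identity in
      \<open>x t\<close>, \<open>z t\<close> and \<open>E t\<close>; no relation between
      \<open>E t\<close> and \<open>z t\<close> enters it.\<close>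
    define P where "P = (E t - 1) * (((s t)^3 + 2 * (s t)\<^sup>2 + 2 * s t) * E t + s t + 2)
      + E t * z t * (s t + 1)\<^sup>2"
    have E1: "E t > 1" using X by (simp add: E_def)
    have Ppos: "P > 0"
      unfolding P_def using X E1 by (intro add_pos_pos mult_pos_pos) auto
    \<comment> \<open>The bordered Hessian in the direction \<open>(u, w)\<close>, which the critical point equation \<open>BA\<close> makes
      tangent to the level curve.\<close>
    have "(B t)\<^sup>2 * g' t = (Bx t * u * B t + Bz t * (B t * w)) * (B t * w)
        - (Ax t * u * B t + Az t * (B t * w)) * (u * B t)"
      by (simp add: g'_def algebra_simps power2_eq_square)
    also have "\<dots> = - (u\<^sup>2 * ((Ax t * B t - A t * Bx t) * B t + A t * (Az t * B t - A t * Bz t)))"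
      unfolding BA by (simp add: algebra_simps power2_eq_square)
    also have "(Ax t * B t - A t * Bx t) * B t + A t * (Az t * B t - A t * Bz t)
        = x t * (s t)\<^sup>2 * P"
      unfolding A_def B_def Ax_def Az_def Bx_def Bz_def P_def s_def
      by (simp add: algebra_simps power2_eq_square power3_eq_cube)
    finally have "(B t)\<^sup>2 * g' t = - (u\<^sup>2 * (x t * (s t)\<^sup>2 * P))" .
    moreover have "u\<^sup>2 * (x t * (s t)\<^sup>2 * P) > 0"
      using u0 X Ppos by simp
    ultimately have "(B t)\<^sup>2 * g' t < 0" by simp
    then show "g' t < 0" by (simp add: mult_less_0_iff)
  qed fact+
  then show ?thesis using t by (simp add: fQ)
qed

lemma link_prob_mono:
  assumes "0 < z" "z \<le> z'" shows "link_prob p z \<le> link_prob p z'"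
proof (cases "p \<le> 0")
  case False
  then have "p / (p + z') * exp (- z') \<le> p / (p + z) * exp (- z)"
    using assms by (intro mult_mono divide_left_mono) auto
  then show ?thesis using False by (simp add: link_prob_def)
qed (simp add: link_prob_def)

text \<open>On a ray through the origin the quotient \<open>p / (p + z)\<close> is constant, so the
  derivative in the ray parameter collapses to a multiple of \<open>exp (- (x * z)) - 1\<close>,
  which is nonpositive.\<close>

lemma link_prob_ray_antimono:
  assumes p: "0 < p" and z: "0 < z" and t: "0 < t" "t \<le> 1"
  shows "link_prob p z \<le> link_prob (t * p) (t * z)"
proof -
  define f where "f = (\<lambda>t. exp (- (t * p)) * (1 - p / (p + z) * exp (- (t * z))))"
  have eq: "link_prob (t * p) (t * z) = f t" if "t > 0" for t
    using p z that mult_pos_pos[of t p] by (simp add: link_prob_def f_def distrib_left[symmetric] del: mult_pos_pos)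
  have "f 1 \<le> f t"
  proof (rule DERIV_nonpos_imp_nonincreasing[OF t(2)])
    fix x assume x: "t \<le> x" "x \<le> 1"
    have "(f has_real_derivative exp (- (x * p)) * p * (exp (- (x * z)) - 1)) (at x)"
      unfolding f_def using p z
      by (auto intro!: derivative_eq_intros simp: divide_simps) (simp add: algebra_simps)
    moreover have "exp (- (x * p)) * p * (exp (- (x * z)) - 1) \<le> 0"
      using p z t x by (intro mult_nonneg_nonpos) auto
    ultimately show "\<exists>y. (f has_real_derivative y) (at x) \<and> y \<le> 0" by blast
  qed
  then show ?thesis using eq[of 1] eq[of t] t by simp
qed

lemma link_prob_bounds:
  assumes "0 \<le> z" shows link_prob_nonneg: "0 \<le> link_prob p z" and link_prob_le_1: "link_prob p z \<le> 1"
proof -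
  have "0 \<le> link_prob p z \<and> link_prob p z \<le> 1"
  proof (cases "p \<le> 0")
    case False
    have "p / (p + z) \<le> 1" using False assms by simp
    then have "p / (p + z) * exp (- z) \<le> 1 * 1"
      using False assms by (intro mult_mono') auto
    moreover have "0 \<le> p / (p + z) * exp (- z)" using False assms by simp
    ultimately have "exp (- p) * (1 - p / (p + z) * exp (- z)) \<le> 1 * 1"
      using False by (intro mult_mono') auto
    then show ?thesis
      using False \<open>p / (p + z) * exp (- z) \<le> 1 * 1\<close> by (simp add: link_prob_def)
  qed (simp add: link_prob_def)
  then show "0 \<le> link_prob p z" "link_prob p z \<le> 1" by auto
qed

text \<open>The end with \<open>p1 \<le> 0\<close> has the maximal value 1, so the other end
  decides. If the mixed point has positive first coordinate \<open>p3\<close>, then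
  \<open>p3 \<le> t * p2\<close>: slide \<open>(p2, z2)\<close> towards the origin along its ray
  until the first coordinate is \<open>p3\<close>, then increase the second coordinate. Neither move
  lowers \<open>link_prob\<close>.\<close>

lemma link_prob_quasiconcave_nonpos:
  assumes p: "p1 \<le> 0" and z: "0 \<le> z1" "0 < z2" and t: "0 \<le> t" "t \<le> 1"
  shows "link_prob p2 z2 \<le> link_prob ((1 - t) * p1 + t * p2) ((1 - t) * z1 + t * z2)"
proof (cases "(1 - t) * p1 + t * p2 \<le> 0")
  case True
  then show ?thesis using link_prob_le_1[of z2 p2] z by (simp add: link_prob_def[of "(1 - t) * p1 + t * p2"])
next
  case False
  define p3 where "p3 = (1 - t) * p1 + t * p2"
  have "(1 - t) * p1 \<le> 0" using p t by (simp add: mult_nonneg_nonpos)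
  then have le: "p3 \<le> t * p2" "0 < p3" using False by (auto simp: p3_def)
  then have p2: "p2 > 0" using t by (smt (verit) mult_nonneg_nonpos)
  define r where "r = p3 / p2"
  have r: "0 < r" "r \<le> t" "p3 = r * p2" using le p2 by (auto simp: r_def divide_simps mult.commute)
  have "link_prob p2 z2 \<le> link_prob (r * p2) (r * z2)" using p2 z r t by (intro link_prob_ray_antimono) auto
  also have "\<dots> \<le> link_prob (r * p2) ((1 - t) * z1 + t * z2)"
  proof (rule link_prob_mono)
    have "r * z2 \<le> t * z2" using r z by (simp add: mult_right_mono)
    also have "\<dots> \<le> (1 - t) * z1 + t * z2" using z t by simp
    finally show "r * z2 \<le> (1 - t) * z1 + t * z2" .
  qed (use r z in simp)
  finally show ?thesis using r by (simp add: p3_def)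
qed

lemma link_prob_quasiconcave:
  assumes z: "0 \<le> z1" "0 \<le> z2" "p1 > 0 \<Longrightarrow> z1 > 0" "p2 > 0 \<Longrightarrow> z2 > 0" and t: "0 \<le> t" "t \<le> 1"
  shows "min (link_prob p1 z1) (link_prob p2 z2) \<le> link_prob ((1 - t) * p1 + t * p2) ((1 - t) * z1 + t * z2)"
proof -
  consider "p1 > 0" "p2 > 0" | "p1 \<le> 0" "p2 > 0" | "p1 > 0" "p2 \<le> 0" | "p1 \<le> 0" "p2 \<le> 0"
    by linarith
  then show ?thesis
  proof cases
    case 1
    then show ?thesis using link_prob_quasiconcave_pos z t by simp
  next
    case 2
    then show ?thesis using link_prob_quasiconcave_nonpos[of p1 z1 z2 t p2] z t by simp
  next
    case 3
    then show ?thesis using link_prob_quasiconcave_nonpos[of p2 z2 z1 "1 - t" p1] z t by (simp add: add.commute)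
  next
    case 4
    then have "(1 - t) * p1 \<le> 0" "t * p2 \<le> 0" using t by (auto simp: mult_nonneg_nonpos)
    with 4 show ?thesis by (simp add: link_prob_def)
  qed
qed

section \<open>Averaging over the interference channel\<close>

text \<open>Write \<open>k x\<close> as the length of the interval \<open>{0<..k x}\<close> and
  exchange the two integrations.\<close>

lemma nn_integral_layer_cake:
  fixes k :: "'a \<Rightarrow> real"
  assumes D: "sigma_finite_measure D" and k[measurable]: "k \<in> borel_measurable D"
    and k01: "\<And>x. x \<in> space D \<Longrightarrow> 0 \<le> k x \<and> k x \<le> 1"
  shows "(\<integral>\<^sup>+x. k x \<partial>D) =
    (\<integral>\<^sup>+u. indicator {0<..1} u * emeasure D {x \<in> space D. u \<le> k x} \<partial>lborel)"
proof -
  interpret D: sigma_finite_measure D by fact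
  interpret pair_sigma_finite D "lborel :: real measure" ..
  have "(\<integral>\<^sup>+x. k x \<partial>D) = (\<integral>\<^sup>+x. \<integral>\<^sup>+u. indicator {0<..1} u * indicator {u. u \<le> k x} u \<partial>lborel \<partial>D)"
  proof (rule nn_integral_cong)
    fix x assume x: "x \<in> space D"
    have "ennreal (k x) = emeasure lborel {0<..k x}" using k01[OF x] by simp
    also have "\<dots> = (\<integral>\<^sup>+u. indicator {0<..k x} u \<partial>lborel)" by simp
    also have "\<dots> = (\<integral>\<^sup>+u. indicator {0<..1} u * indicator {u. u \<le> k x} u \<partial>lborel)"
      using k01[OF x] by (intro nn_integral_cong) (auto split: split_indicator)
    finally show "ennreal (k x) = \<dots>" .
  qed
  also have "\<dots> = (\<integral>\<^sup>+u. \<integral>\<^sup>+x. indicator {0<..1} u * indicator {u. u \<le> k x} u \<partial>D \<partial>lborel)"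
    by (rule Fubini'[symmetric]) measurable
  also have "\<dots> = (\<integral>\<^sup>+u. indicator {0<..1} u * emeasure D {x \<in> space D. u \<le> k x} \<partial>lborel)"
  proof (rule nn_integral_cong)
    fix u :: real
    have "(\<integral>\<^sup>+x. indicator {0<..1} u * indicator {u. u \<le> k x} u \<partial>D)
        = (\<integral>\<^sup>+x. indicator {0<..1} u * indicator {x \<in> space D. u \<le> k x} x \<partial>D)"
      by (intro nn_integral_cong) (auto split: split_indicator)
    also have "\<dots> = indicator {0<..1} u * emeasure D {x \<in> space D. u \<le> k x}"
      by (subst nn_integral_cmult_indicator) auto
    finally show "(\<integral>\<^sup>+x. indicator {0<..1} u * indicator {u. u \<le> k x} u \<partial>D) = \<dots>" .
  qed
  finally show ?thesis .
qed

lemma emeasure_exponential_atMost: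
  assumes "0 < l" "0 \<le> w"
  shows "emeasure (density lborel (exponential_density l)) {..w} = ennreal (1 - exp (- l * w))"
  using emeasure_erlang_density[of l 0 w] assms by (simp add: erlang_CDF_0)

text \<open>The law has no atoms. Both forms are wanted because superlevel sets will be enclosed in
  closed half-lines from outside and bounded by open ones from inside.\<close>

lemma emeasure_exponential_lessThan:
  assumes "0 < l" "0 \<le> w"
  shows "emeasure (density lborel (exponential_density l)) {..<w} = ennreal (1 - exp (- l * w))"
proof -
  have "emeasure (density lborel (exponential_density l)) {..<w}
      = emeasure (density lborel (exponential_density l)) {..w}"
  proof (rule emeasure_eq_AE)
    have "AE x in lborel. x \<noteq> w" by (rule AE_lborel_singleton)
    then show "AE x in density lborel (exponential_density l). x \<in> {..<w} \<longleftrightarrow> x \<in> {..w}"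
      by (subst AE_density) (auto elim: eventually_mono)
  qed simp_all
  then show ?thesis using emeasure_exponential_atMost[OF assms] by simp
qed

lemma exponential_cdf_concave:
  fixes l t x y :: real
  assumes "0 \<le> t" "t \<le> 1"
  shows "(1 - t) * (1 - exp (- l * x)) + t * (1 - exp (- l * y))
    \<le> 1 - exp (- l * ((1 - t) * x + t * y))"
proof -
  have "convex_on UNIV (exp :: real \<Rightarrow> real)" by (simp add: exp_convex)
  from convex_onD[OF this assms, of "- l * x" "- l * y"]
  show ?thesis by (simp add: algebra_simps)
qed

text \<open>A Prekopa-Leindler type inequality for the exponential law. At each level
  \<open>u\<close> the superlevel sets of \<open>k1\<close> and \<open>k2\<close> are half-lines
  with ends \<open>w1\<close> and \<open>w2\<close>, and \<open>mix\<close> puts every point below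
  \<open>(1 - t) * w1 + t * w2\<close> into the superlevel set of \<open>k3\<close>. Concavity of
  the distribution function compares the measures level by level, and the layer cake formula
  integrates over \<open>u\<close>.\<close>

lemma exponential_integral_quasiconcave:
  fixes k1 k2 k3 :: "real \<Rightarrow> real" and l t b :: real
  assumes l: "0 < l" and t: "0 \<le> t" "t \<le> 1"
    and k[measurable]: "k1 \<in> borel_measurable borel" "k2 \<in> borel_measurable borel"
      "k3 \<in> borel_measurable borel"
    and k01: "\<And>x. 0 \<le> k1 x \<and> k1 x \<le> 1" "\<And>x. 0 \<le> k2 x \<and> k2 x \<le> 1" "\<And>x. 0 \<le> k3 x \<and> k3 x \<le> 1"
    and one: "\<And>x. x \<le> 0 \<Longrightarrow> k1 x = 1" "\<And>x. x \<le> 0 \<Longrightarrow> k2 x = 1" "\<And>x. x \<le> 0 \<Longrightarrow> k3 x = 1"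
    and dec: "\<And>x y. 0 \<le> x \<Longrightarrow> x \<le> y \<Longrightarrow> k1 y \<le> k1 x" "\<And>x y. 0 \<le> x \<Longrightarrow> x \<le> y \<Longrightarrow> k2 y \<le> k2 x"
    and bdd: "\<And>x. b < x \<Longrightarrow> k1 x = 0" "\<And>x. b < x \<Longrightarrow> k2 x = 0"
    and mix: "\<And>x1 x2. 0 \<le> x1 \<Longrightarrow> 0 \<le> x2 \<Longrightarrow> min (k1 x1) (k2 x2) \<le> k3 ((1 - t) * x1 + t * x2)"
  defines "D \<equiv> density lborel (exponential_density l)"
  shows "ennreal (1 - t) * (\<integral>\<^sup>+x. k1 x \<partial>D) + ennreal t * (\<integral>\<^sup>+x. k2 x \<partial>D) \<le> (\<integral>\<^sup>+x. k3 x \<partial>D)"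
proof -
  interpret D: prob_space D unfolding D_def using l by (rule prob_space_exponential_density)
  have sD[measurable_cong, simp]: "sets D = sets borel" and spD[simp]: "space D = UNIV" by (simp_all add: D_def)
  have key: "ennreal (1 - t) * emeasure D {x. u \<le> k1 x} + ennreal t * emeasure D {x. u \<le> k2 x}
      \<le> emeasure D {x. u \<le> k3 x}" if u: "0 < u" "u \<le> 1" for u
  proof -
    \<comment> \<open>The witness is the supremum of the superlevel set, finite by
      \<open>bdd\<close>. It need not belong to the set, hence the strict inequality in the last
      conjunct.\<close>
    have ex: "\<exists>w\<ge>0. {x. u \<le> k x} \<subseteq> {..w} \<and> (\<forall>x. 0 \<le> x \<longrightarrow> x < w \<longrightarrow> u \<le> k x)"
      if one: "\<And>x. x \<le> 0 \<Longrightarrow> k x = 1" and dec: "\<And>x y. 0 \<le> x \<Longrightarrow> x \<le> y \<Longrightarrow> k y \<le> k x"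
        and bdd: "\<And>x. b < x \<Longrightarrow> k x = 0" for k :: "real \<Rightarrow> real"
    proof -
      let ?A = "{x. u \<le> k x}"
      have 0: "0 \<in> ?A" using one[of 0] u by simp
      have bd: "bdd_above ?A" using bdd u by (intro bdd_aboveI[of _ b]) (force simp: not_less[symmetric])
      have "u \<le> k x" if x: "0 \<le> x" "x < Sup ?A" for x
      proof -
        obtain y where "y \<in> ?A" "x < y" using x(2) less_cSup_iff[OF _ bd] 0 by blast
        then show ?thesis using dec[of x y] x(1) by auto
      qed
      then show ?thesis
        using cSup_upper[OF _ bd] 0 by (intro exI[of _ "Sup ?A"]) auto
    qed
    obtain w1 where w1: "0 \<le> w1" "{x. u \<le> k1 x} \<subseteq> {..w1}" "\<And>x. 0 \<le> x \<Longrightarrow> x < w1 \<Longrightarrow> u \<le> k1 x"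
      using ex[of k1] one(1) dec(1) bdd(1) by blast
    obtain w2 where w2: "0 \<le> w2" "{x. u \<le> k2 x} \<subseteq> {..w2}" "\<And>x. 0 \<le> x \<Longrightarrow> x < w2 \<Longrightarrow> u \<le> k2 x"
      using ex[of k2] one(2) dec(2) bdd(2) by blast
    define w where "w = (1 - t) * w1 + t * w2"
    have w0: "0 \<le> w" using t w1 w2 by (simp add: w_def)
    have sub: "{..<w} \<subseteq> {x. u \<le> k3 x}"
    proof safe
      fix v assume v: "v < w"
      show "u \<le> k3 v"
      proof (cases "v \<le> 0")
        case True
        then show ?thesis using one(3) u by simp
      next
        case False
        \<comment> \<open>Shrinking both ends by the common factor \<open>r < 1\<close> reaches
          \<open>v\<close> from points strictly inside the two half-lines, where the level
          \<open>u\<close> is certainly attained. An end equal to 0 does not move, but there the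
          function is 1.\<close>
        define r where "r = v / w"
        have r: "0 < r" "r < 1" "v = r * w" using False v by (auto simp: r_def)
        have "u \<le> k1 (r * w1)" "u \<le> k2 (r * w2)"
          using w1 w2 r one(1)[of 0] one(2)[of 0] u
          by (cases "w1 = 0"; cases "w2 = 0"; simp)+
        then have "u \<le> k3 ((1 - t) * (r * w1) + t * (r * w2))"
          using mix[of "r * w1" "r * w2"] w1 w2 r by simp
        then show ?thesis by (simp add: r(3) w_def algebra_simps)
      qed
    qed
    have e: "emeasure D {x. u \<le> k1 x} \<le> ennreal (1 - exp (- l * w1))"
      "emeasure D {x. u \<le> k2 x} \<le> ennreal (1 - exp (- l * w2))"
      using emeasure_mono[OF w1(2), of D] emeasure_mono[OF w2(2), of D] emeasure_exponential_atMost[OF l] w1(1) w2(1)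
      by (simp_all add: D_def)
    have nn: "0 \<le> 1 - exp (- l * w1)" "0 \<le> 1 - exp (- l * w2)" using l w1 w2 by auto
    have "ennreal (1 - t) * emeasure D {x. u \<le> k1 x} + ennreal t * emeasure D {x. u \<le> k2 x}
        \<le> ennreal (1 - t) * ennreal (1 - exp (- l * w1)) + ennreal t * ennreal (1 - exp (- l * w2))"
      by (intro add_mono mult_left_mono e) auto
    also have "\<dots> = ennreal ((1 - t) * (1 - exp (- l * w1)) + t * (1 - exp (- l * w2)))"
      using t nn by (simp add: ennreal_mult ennreal_plus)
    also have "\<dots> \<le> ennreal (1 - exp (- l * w))"
      unfolding w_def by (intro ennreal_leI exponential_cdf_concave t)
    also have "\<dots> = emeasure D {..<w}"
      unfolding D_def by (rule emeasure_exponential_lessThan[symmetric, OF l w0])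
    also have "\<dots> \<le> emeasure D {x. u \<le> k3 x}"
      by (intro emeasure_mono sub) simp
    finally show ?thesis .
  qed
  have lc: "(\<integral>\<^sup>+x. k x \<partial>D) = (\<integral>\<^sup>+u. indicator {0<..1} u * emeasure D {x. u \<le> k x} \<partial>lborel)"
    if "k \<in> borel_measurable borel" "\<And>x. 0 \<le> k x \<and> k x \<le> 1" for k :: "real \<Rightarrow> real"
    using that nn_integral_layer_cake[of D k] D.sigma_finite_measure_axioms by (simp cong: measurable_cong_sets)
  \<comment> \<open>Measurability in the level \<open>u\<close> comes from writing the measure as a
    section integral of a jointly measurable indicator.\<close>
  have me[measurable]: "(\<lambda>u. emeasure D {x. u \<le> k x}) \<in> borel_measurable borel"
    if [measurable]: "k \<in> borel_measurable borel" for k :: "real \<Rightarrow> real"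
  proof -
    have "(\<lambda>u. \<integral>\<^sup>+x. indicator {(u, x). u \<le> k x} (u, x) \<partial>D) \<in> borel_measurable borel"
      by measurable
    also have "(\<lambda>u. \<integral>\<^sup>+x. indicator {(u, x). u \<le> k x} (u, x) \<partial>D) = (\<lambda>u. emeasure D {x. u \<le> k x})"
    proof
      fix u
      have "(\<integral>\<^sup>+x. indicator {(u, x). u \<le> k x} (u, x) \<partial>D) = (\<integral>\<^sup>+x. indicator {x. u \<le> k x} x \<partial>D)"
        by (intro nn_integral_cong) (simp split: split_indicator)
      also have "\<dots> = emeasure D {x. u \<le> k x}" by (rule nn_integral_indicator) simp
      finally show "(\<integral>\<^sup>+x. indicator {(u, x). u \<le> k x} (u, x) \<partial>D) = emeasure D {x. u \<le> k x}" .
    qed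
    finally show ?thesis .
  qed
  have "ennreal (1 - t) * (\<integral>\<^sup>+x. k1 x \<partial>D) + ennreal t * (\<integral>\<^sup>+x. k2 x \<partial>D) =
    (\<integral>\<^sup>+u. ennreal (1 - t) * (indicator {0<..1} u * emeasure D {x. u \<le> k1 x})
      + ennreal t * (indicator {0<..1} u * emeasure D {x. u \<le> k2 x}) \<partial>lborel)"
    using k k01 by (simp add: lc nn_integral_add nn_integral_cmult)
  also have "\<dots> \<le> (\<integral>\<^sup>+u. indicator {0<..1} u * emeasure D {x. u \<le> k3 x} \<partial>lborel)"
    using key by (intro nn_integral_mono) (auto split: split_indicator)
  also have "\<dots> = (\<integral>\<^sup>+x. k3 x \<partial>D)" using k k01 by (simp add: lc)
  finally show ?thesis .
qed

text \<open>The conditional success probability given the gains \<open>s\<close>, \<open>y\<close>, \<open>x\<close> of the source-relay,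
  source-destination and source-primary links, with \<open>a = \<gamma>\<^sub>t\<^sub>h * N\<^sub>o / I\<close>.\<close>

definition cond_success :: "nat \<Rightarrow> real \<Rightarrow> real \<Rightarrow> real \<Rightarrow> real \<Rightarrow> real \<Rightarrow> real \<Rightarrow> real \<Rightarrow> real \<Rightarrow> real" where
  "cond_success L a lrd lrp s y xi be x =
    (if a * x \<le> xi * s
     then 1 - (1 - link_prob (lrd * (a * x - y) / (be * s)) (lrp * x / (be * s))) ^ L else 0)"

lemma cond_success_measurable: "cond_success L a lrd lrp s y xi be \<in> borel_measurable borel"
  unfolding cond_success_def link_prob_def by measurable

section \<open>Concavity after averaging over the source-primary gain\<close>

context
  fixes L :: nat and a lrd lrp s y :: real
  assumes L: "1 \<le> L" and pos: "0 < a" "0 < lrd" "0 < lrp" "0 < s" "0 \<le> y"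
begin

text \<open>The decoding constraint \<open>a * x \<le> xi * s\<close> is linear in
  \<open>(x, xi)\<close>, so it survives mixing if it holds at both ends; then quasiconcavity of
  \<open>link_prob\<close> carries over, as \<open>1 - (1 - q) ^ L\<close> is increasing in
  \<open>q\<close>. If it fails at one end, the minimum on the left is at most 0.\<close>

lemma cond_success_quasiconcave:
  assumes be: "0 < be1" "0 < be2" and t: "0 \<le> t" "t \<le> 1" and x: "0 \<le> x1" "0 \<le> x2"
  shows "min (cond_success L a lrd lrp s y xi1 be1 x1) (cond_success L a lrd lrp s y xi2 be2 x2)
    \<le> cond_success L a lrd lrp s y ((1 - t) * xi1 + t * xi2) ((1 - t) * be1 + t * be2) ((1 - t) * x1 + t * x2)"
proof -
  define be where "be = (1 - t) * be1 + t * be2"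
  define x where "x = (1 - t) * x1 + t * x2"
  have be0: "be > 0" unfolding be_def using be t by (rule convex_combination_pos)
  have x0: "x \<ge> 0" unfolding x_def using x t by simp
  define r where "r = t * be2 / be"
  have r: "0 \<le> r" "r \<le> 1" "1 - r = (1 - t) * be1 / be"
    using be t be0 by (auto simp: r_def be_def divide_simps)
  define p where "p = (\<lambda>x be. lrd * (a * x - y) / (be * s))"
  define z where "z = (\<lambda>x be. lrp * x / (be * s))"
  \<comment> \<open>The arguments are affine functions of \<open>(x / be, 1 / be)\<close>, and \<open>(x, be) \<mapsto> (x / be, 1 / be)\<close> maps
    segments to segments, with the weights \<open>t\<close> replaced by \<open>r\<close>.\<close>
  have p: "p x be = (1 - r) * p x1 be1 + r * p x2 be2"
    unfolding r(3) using be be0 pos by (simp add: p_def r_def x_def divide_simps) (simp add: algebra_simps)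
  have z: "z x be = (1 - r) * z x1 be1 + r * z x2 be2"
    unfolding r(3) using be be0 pos by (simp add: z_def r_def x_def divide_simps) (simp add: algebra_simps)
  \<comment> \<open>As \<open>y \<ge> 0\<close>, a positive first argument excludes
    \<open>v = 0\<close>; this keeps \<open>link_prob\<close> away from the corner where its
    quasiconcavity was not shown.\<close>
  have zpos: "0 < z v c" if "0 < p v c" "c > 0" "0 \<le> v" for v c
  proof -
    have "v \<noteq> 0" using that pos by (auto simp: p_def zero_less_divide_iff mult_less_0_iff zero_less_mult_iff)
    then show ?thesis using that pos by (simp add: z_def)
  qed
  have z0: "0 \<le> z v c" if "c > 0" "0 \<le> v" for v c
    using that pos by (simp add: z_def)
  have Q: "min (link_prob (p x1 be1) (z x1 be1)) (link_prob (p x2 be2) (z x2 be2)) \<le> link_prob (p x be) (z x be)"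
    unfolding p z using be x r by (intro link_prob_quasiconcave z0 zpos) auto
  have mono: "1 - (1 - q) ^ L \<le> 1 - (1 - q') ^ L" if "q \<le> q'" "q' \<le> 1" for q q' :: real
    using that by (simp add: power_mono)
  show ?thesis
  proof (cases "a * x1 \<le> xi1 * s \<and> a * x2 \<le> xi2 * s")
    case True
    have "a * x = (1 - t) * (a * x1) + t * (a * x2)" by (simp add: x_def algebra_simps)
    also have "\<dots> \<le> (1 - t) * (xi1 * s) + t * (xi2 * s)"
      using True t by (intro add_mono mult_left_mono) auto
    also have "\<dots> = ((1 - t) * xi1 + t * xi2) * s" by (simp add: algebra_simps)
    finally have "cond_success L a lrd lrp s y ((1 - t) * xi1 + t * xi2) be x = 1 - (1 - link_prob (p x be) (z x be)) ^ L"
      by (simp add: cond_success_def p_def z_def)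
    moreover have "min (1 - (1 - link_prob (p x1 be1) (z x1 be1)) ^ L) (1 - (1 - link_prob (p x2 be2) (z x2 be2)) ^ L)
        \<le> 1 - (1 - link_prob (p x be) (z x be)) ^ L"
      using Q mono[of "link_prob (p x1 be1) (z x1 be1)" "link_prob (p x be) (z x be)"]
        mono[of "link_prob (p x2 be2) (z x2 be2)" "link_prob (p x be) (z x be)"] link_prob_le_1[OF z0[OF be0 x0], of "p x be"]
      by (auto simp: min_le_iff_disj)
    ultimately show ?thesis using True
      unfolding be_def[symmetric] x_def[symmetric] by (simp add: cond_success_def p_def z_def)
  next
    case False
    have "0 \<le> cond_success L a lrd lrp s y ((1 - t) * xi1 + t * xi2) be x"
      using link_prob_bounds[OF z0[OF be0 x0], of "p x be"] L
      by (simp add: cond_success_def p_def z_def power_le_one)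
    with False show ?thesis
      unfolding be_def[symmetric] x_def[symmetric] by (auto simp: cond_success_def min_le_iff_disj)
  qed
qed

text \<open>Negative \<open>x\<close> carry no mass under the exponential law; the value there only
  has to fit the hypotheses of the averaging lemma. The value at 0 also yields the monotonicity
  below.\<close>

lemma cond_success_eq_1: assumes "0 < be" "0 \<le> xi" "x \<le> 0" shows "cond_success L a lrd lrp s y xi be x = 1"
proof -
  have *: "a * x \<le> 0" "0 \<le> xi * s" "0 < be * s" using pos assms by (auto simp: mult_nonneg_nonpos)
  then have "lrd * (a * x - y) \<le> 0" using pos by (intro mult_nonneg_nonpos) auto
  with * have "a * x \<le> xi * s" "lrd * (a * x - y) / (be * s) \<le> 0"
    by (linarith, simp add: divide_le_0_iff)
  then show ?thesis using L by (simp add: cond_success_def link_prob_def)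
qed

lemma cond_success_bounds: assumes "0 < be" "0 \<le> xi"
  shows "0 \<le> cond_success L a lrd lrp s y xi be x \<and> cond_success L a lrd lrp s y xi be x \<le> 1"
proof (cases "x \<le> 0")
  case True
  then show ?thesis using cond_success_eq_1 assms by simp
next
  case False
  then have "0 \<le> lrp * x / (be * s)" using pos assms by simp
  then show ?thesis using link_prob_bounds[of "lrp * x / (be * s)" "lrd * (a * x - y) / (be * s)"]
    by (simp add: cond_success_def power_le_one)
qed

text \<open>Quasiconcavity with \<open>xi\<close> and \<open>be\<close> held fixed suffices: the
  maximal value 1 is attained at 0, so at every point between 0 and \<open>x'\<close> the value is
  at least the one at \<open>x'\<close>.\<close>

lemma cond_success_antimono:
  assumes be: "0 < be" "0 \<le> xi" and x: "0 \<le> x" "x \<le> x'"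
  shows "cond_success L a lrd lrp s y xi be x' \<le> cond_success L a lrd lrp s y xi be x"
proof (cases "x' = 0")
  case False
  define t where "t = x / x'"
  have t: "0 \<le> t" "t \<le> 1" "t * x' = x" using x False by (auto simp: t_def)
  have "min (cond_success L a lrd lrp s y xi be 0) (cond_success L a lrd lrp s y xi be x')
    \<le> cond_success L a lrd lrp s y ((1 - t) * xi + t * xi) ((1 - t) * be + t * be) ((1 - t) * 0 + t * x')"
    using be t x by (intro cond_success_quasiconcave) auto
  then have "min (cond_success L a lrd lrp s y xi be 0) (cond_success L a lrd lrp s y xi be x') \<le> cond_success L a lrd lrp s y xi be x"
    using t by (simp add: algebra_simps)
  then show ?thesis using cond_success_eq_1[of be xi 0] cond_success_bounds[OF be, of x'] be by auto
qed (use x in simp)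

lemma cond_success_integral_concave:
  assumes be: "0 < be1" "0 < be2" and xi: "0 \<le> xi1" "0 \<le> xi2" and t: "0 \<le> t" "t \<le> 1" and l: "0 < l"
  defines "D \<equiv> density lborel (exponential_density l)"
  shows "ennreal (1 - t) * (\<integral>\<^sup>+x. cond_success L a lrd lrp s y xi1 be1 x \<partial>D)
      + ennreal t * (\<integral>\<^sup>+x. cond_success L a lrd lrp s y xi2 be2 x \<partial>D)
    \<le> (\<integral>\<^sup>+x. cond_success L a lrd lrp s y ((1 - t) * xi1 + t * xi2) ((1 - t) * be1 + t * be2) x \<partial>D)"
  unfolding D_def
proof (rule exponential_integral_quasiconcave[OF l t cond_success_measurable cond_success_measurable cond_success_measurable,
      where b = "max (xi1 * s / a) (xi2 * s / a)"])
  have be3: "(1 - t) * be1 + t * be2 > 0" using be t by (rule convex_combination_pos)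
  have xi3: "0 \<le> (1 - t) * xi1 + t * xi2" using xi t by simp
  show "0 \<le> cond_success L a lrd lrp s y ((1 - t) * xi1 + t * xi2) ((1 - t) * be1 + t * be2) x \<and>
    cond_success L a lrd lrp s y ((1 - t) * xi1 + t * xi2) ((1 - t) * be1 + t * be2) x \<le> 1" for x
    using be3 xi3 by (rule cond_success_bounds)
  show "cond_success L a lrd lrp s y ((1 - t) * xi1 + t * xi2) ((1 - t) * be1 + t * be2) x = 1" if "x \<le> 0" for x
    using be3 xi3 that by (rule cond_success_eq_1)
  \<comment> \<open>Beyond \<open>xi * s / a\<close> the relay cannot decode, which explains the
    choice of \<open>b\<close>.\<close>
  show "cond_success L a lrd lrp s y xi1 be1 x = 0" "cond_success L a lrd lrp s y xi2 be2 x = 0"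
    if "max (xi1 * s / a) (xi2 * s / a) < x" for x
    using that pos by (auto simp: cond_success_def divide_less_eq mult.commute)
qed (use be xi t in \<open>auto intro!: cond_success_quasiconcave cond_success_antimono cond_success_eq_1 cond_success_bounds[THEN conjunct1] cond_success_bounds[THEN conjunct2]\<close>)

end

section \<open>Independent exponential gains\<close>

text \<open>This replaces conditioning: \<open>\<omega>\<close> freezes \<open>A\<close> while a
  second outcome \<open>\<omega>'\<close> of the same space averages over \<open>B\<close>.
  Independence makes the joint law a product, and both factors are pulled back to
  \<open>M\<close>.\<close>

lemma (in prob_space) indep_var_nn_integral_decouple:
  assumes AB: "indep_var MA A MB B" and f[measurable]: "f \<in> borel_measurable (MA \<Otimes>\<^sub>M MB)"
  shows "(\<integral>\<^sup>+\<omega>. f (A \<omega>, B \<omega>) \<partial>M) = (\<integral>\<^sup>+\<omega>. \<integral>\<^sup>+\<omega>'. f (A \<omega>, B \<omega>') \<partial>M \<partial>M)"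
proof -
  have [measurable]: "A \<in> measurable M MA" "B \<in> measurable M MB"
    using indep_var_rv1[OF AB] indep_var_rv2[OF AB] .
  interpret A: prob_space "distr M MA A" by (rule prob_space_distr) measurable
  interpret B: prob_space "distr M MB B" by (rule prob_space_distr) measurable
  interpret pair_sigma_finite "distr M MA A" "distr M MB B" ..
  have "(\<integral>\<^sup>+\<omega>. f (A \<omega>, B \<omega>) \<partial>M) = (\<integral>\<^sup>+z. f z \<partial>distr M (MA \<Otimes>\<^sub>M MB) (\<lambda>\<omega>. (A \<omega>, B \<omega>)))"
    by (subst nn_integral_distr) auto
  also have "distr M (MA \<Otimes>\<^sub>M MB) (\<lambda>\<omega>. (A \<omega>, B \<omega>)) = distr M MA A \<Otimes>\<^sub>M distr M MB B"
    using AB by (simp add: indep_var_distribution_eq)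
  also have "(\<integral>\<^sup>+z. f z \<partial>(distr M MA A \<Otimes>\<^sub>M distr M MB B))
      = (\<integral>\<^sup>+a. \<integral>\<^sup>+b. f (a, b) \<partial>distr M MB B \<partial>distr M MA A)"
    by (subst B.nn_integral_fst[symmetric]) auto
  also have "\<dots> = (\<integral>\<^sup>+a. \<integral>\<^sup>+\<omega>'. f (a, B \<omega>') \<partial>M \<partial>distr M MA A)"
    by (intro nn_integral_cong, subst nn_integral_distr) auto
  also have "\<dots> = (\<integral>\<^sup>+\<omega>. \<integral>\<^sup>+\<omega>'. f (A \<omega>, B \<omega>') \<partial>M \<partial>M)"
    by (subst nn_integral_distr) auto
  finally show ?thesis .
qed

section \<open>The exponential law of the squared modulus of a circular Gaussian\<close>

lemma emeasure_norm_square_le: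
  assumes "0 \<le> r"
  shows "emeasure lborel {z :: complex. (cmod z)\<^sup>2 \<le> r} = ennreal (pi * r)"
proof -
  have "{z :: complex. (cmod z)\<^sup>2 \<le> r} = cball 0 (sqrt r)"
    using assms by (auto simp: real_le_rsqrt dest: real_sqrt_le_mono) (metis norm_ge_zero real_le_lsqrt real_sqrt_le_iff real_sqrt_pow2 real_sqrt_power sqrt_le_D)
  then show ?thesis using assms by (simp add: emeasure_cball unit_ball_vol_2)
qed

text \<open>Polar coordinates are avoided. On the disc \<open>A t\<close> the density at
  \<open>z\<close> equals its value on the boundary circle plus the integral of
  \<open>c * (exp (- s / v) / v)\<close> over \<open>s\<close> from \<open>(cmod z)\<^sup>2\<close>
  to \<open>t\<close>. After Fubini the integral over \<open>z\<close> is the area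
  \<open>pi * s\<close> of a disc, and a one-dimensional integral remains.\<close>

lemma (in prob_space) circular_gaussian_norm_square_exponential:
  assumes X: "circular_gaussian M X v" and v: "0 < v"
  shows "distributed M lborel (\<lambda>\<omega>. (cmod (X \<omega>))\<^sup>2) (exponential_density (inverse v))"
proof -
  let ?f = "\<lambda>z :: complex. ennreal (exp (- (cmod z)\<^sup>2 / v) / (pi * v))"
  have D: "distributed M lborel X ?f" using X by (simp add: circular_gaussian_def)
  have [measurable]: "X \<in> borel_measurable M"
    using distributed_measurable[OF D] by simp
  have "prob {\<omega> \<in> space M. (cmod (X \<omega>))\<^sup>2 \<le> t} = 1 - exp (- t * inverse v)" if t: "0 \<le> t" for t
  proof -
    define c where "c = 1 / (pi * v)"
    have c: "c > 0" using v by (simp add: c_def)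
    define A where "A = (\<lambda>s. {z :: complex. (cmod z)\<^sup>2 \<le> s})"
    have A[measurable]: "A s \<in> sets borel" for s unfolding A_def by measurable
    have FTC: "(\<integral>\<^sup>+s. ennreal (exp (- s / v) / v) * indicator {b..t} s \<partial>lborel)
        = ennreal (exp (- b / v) - exp (- t / v))" if "b \<le> t" for b
    proof -
      have "(\<integral>\<^sup>+s. ennreal (exp (- s / v) / v) * indicator {b..t} s \<partial>lborel)
          = - exp (- t / v) - - exp (- b / v)"
        using v that by (intro nn_integral_FTC_Icc) (auto intro!: derivative_eq_intros simp: divide_simps)
      then show ?thesis by simp
    qed
    have "emeasure M {\<omega> \<in> space M. (cmod (X \<omega>))\<^sup>2 \<le> t} = emeasure M (X -` A t \<inter> space M)"
      by (rule arg_cong[where f = "emeasure M"]) (auto simp: A_def)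
    also have "\<dots> = (\<integral>\<^sup>+z. ?f z * indicator (A t) z \<partial>lborel)"
      by (rule distributed_emeasure[OF D]) simp
    also have "\<dots> = (\<integral>\<^sup>+z. ennreal (c * exp (- t / v)) * indicator (A t) z +
        (\<integral>\<^sup>+s. ennreal (c * (exp (- s / v) / v)) * (indicator {0..t} s * indicator {z. (cmod z)\<^sup>2 \<le> s} z) \<partial>lborel) \<partial>lborel)"
    proof (rule nn_integral_cong)
      fix z :: complex
      show "?f z * indicator (A t) z = ennreal (c * exp (- t / v)) * indicator (A t) z +
        (\<integral>\<^sup>+s. ennreal (c * (exp (- s / v) / v)) * (indicator {0..t} s * indicator {z. (cmod z)\<^sup>2 \<le> s} z) \<partial>lborel)"
      proof (cases "(cmod z)\<^sup>2 \<le> t")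
        case True
        have "(\<integral>\<^sup>+s. ennreal (c * (exp (- s / v) / v)) * (indicator {0..t} s * indicator {z. (cmod z)\<^sup>2 \<le> s} z) \<partial>lborel)
            = (\<integral>\<^sup>+s. ennreal c * (ennreal (exp (- s / v) / v) * indicator {(cmod z)\<^sup>2..t} s) \<partial>lborel)"
          using c v by (intro nn_integral_cong) (auto simp: ennreal_mult'[symmetric] split: split_indicator intro: order_trans[OF zero_le_power2])
        also have "\<dots> = ennreal c * ennreal (exp (- (cmod z)\<^sup>2 / v) - exp (- t / v))"
          by (subst nn_integral_cmult) (simp, simp only: FTC[OF True])
        also have "\<dots> = ennreal (c * (exp (- (cmod z)\<^sup>2 / v) - exp (- t / v)))"
          using c by (simp add: ennreal_mult')
        finally show ?thesis
          using True c v by (simp add: A_def ennreal_plus[symmetric] divide_right_mono del: ennreal_plus)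
             (simp add: c_def algebra_simps)
      next
        case False
        then have *: "indicator {0..t} s * indicator {z. (cmod z)\<^sup>2 \<le> s} z = (0 :: ennreal)" for s
          by (auto split: split_indicator)
        show ?thesis unfolding * using False by (simp add: A_def)
      qed
    qed
    also have "\<dots> = (\<integral>\<^sup>+z. ennreal (c * exp (- t / v)) * indicator (A t) z \<partial>lborel) +
        (\<integral>\<^sup>+z. \<integral>\<^sup>+s. ennreal (c * (exp (- s / v) / v)) * (indicator {0..t} s * indicator {z. (cmod z)\<^sup>2 \<le> s} z) \<partial>lborel \<partial>lborel)"
      by (rule nn_integral_add) measurable
    also have "(\<integral>\<^sup>+z. ennreal (c * exp (- t / v)) * indicator (A t) z \<partial>lborel) = ennreal (t / v * exp (- t / v))"
      using c v t by (simp add: nn_integral_cmult_indicator A_def emeasure_norm_square_le ennreal_mult'[symmetric])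
         (simp add: c_def mult.commute)
    also have "(\<integral>\<^sup>+z. \<integral>\<^sup>+s. ennreal (c * (exp (- s / v) / v)) * (indicator {0..t} s * indicator {z. (cmod z)\<^sup>2 \<le> s} z) \<partial>lborel \<partial>(lborel :: complex measure))
        = (\<integral>\<^sup>+s. \<integral>\<^sup>+z. ennreal (c * (exp (- s / v) / v)) * (indicator {0..t} s * indicator {z. (cmod z)\<^sup>2 \<le> s} z) \<partial>(lborel :: complex measure) \<partial>lborel)"
      by (rule lborel_pair.Fubini') measurable
    also have "\<dots> = (\<integral>\<^sup>+s. ennreal (s / v\<^sup>2 * exp (- s / v)) * indicator {0..t} s \<partial>lborel)"
    proof (rule nn_integral_cong)
      fix s :: real
      have "(\<integral>\<^sup>+z. ennreal (c * (exp (- s / v) / v)) * (indicator {0..t} s * indicator {z. (cmod z)\<^sup>2 \<le> s} z) \<partial>(lborel :: complex measure))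
        = (\<integral>\<^sup>+z. (ennreal (c * (exp (- s / v) / v)) * indicator {0..t} s) * indicator (A s) z \<partial>(lborel :: complex measure))"
        by (simp add: A_def mult.assoc)
      also have "\<dots> = ennreal (c * (exp (- s / v) / v)) * indicator {0..t} s * emeasure lborel (A s)"
        by (subst nn_integral_cmult_indicator) auto
      also have "\<dots> = ennreal (s / v\<^sup>2 * exp (- s / v)) * indicator {0..t} s"
        using c v by (auto simp: A_def emeasure_norm_square_le ennreal_mult'[symmetric] split: split_indicator)
           (simp add: c_def power2_eq_square)
      finally show "(\<integral>\<^sup>+z. ennreal (c * (exp (- s / v) / v)) * (indicator {0..t} s * indicator {z. (cmod z)\<^sup>2 \<le> s} z) \<partial>(lborel :: complex measure)) = \<dots>" .
    qed
    \<comment> \<open>The antiderivative used is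
      \<open>- (1 + s / v) * exp (- s / v)\<close>.\<close>
    also have "\<dots> = - (1 + t / v) * exp (- t / v) - - (1 + 0 / v) * exp (- 0 / v)"
      using v t by (intro nn_integral_FTC_Icc)
         (auto intro!: derivative_eq_intros simp: field_simps power2_eq_square)
    finally have "emeasure M {\<omega> \<in> space M. (cmod (X \<omega>))\<^sup>2 \<le> t} = ennreal (1 - exp (- t / v))"
    proof -
      have "0 \<le> 1 - (1 + t / v) * exp (- t / v)"
        using exp_ge_add_one_self[of "t / v"] by (simp add: exp_minus field_simps)
      then show ?thesis if "emeasure M {\<omega> \<in> space M. (cmod (X \<omega>))\<^sup>2 \<le> t} =
          ennreal (t / v * exp (- t / v)) + ennreal (- (1 + t / v) * exp (- t / v) - - (1 + 0 / v) * exp (- 0 / v))"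
        unfolding that using t v by (subst ennreal_plus[symmetric]) (auto simp: algebra_simps)
    qed
    moreover have "0 \<le> 1 - exp (- t / v)" using t v by simp
    ultimately show ?thesis by (simp add: emeasure_eq_measure divide_inverse)
  qed
  then show ?thesis using v by (simp add: exponential_distributed_iff)
qed

section \<open>Success of a single relay link\<close>

lemma (in prob_space) exponential_pos_AE:
  assumes X: "distributed M lborel X (exponential_density l)" and l: "0 < l"
  shows "AE \<omega> in M. 0 < X \<omega>"
proof -
  have [measurable]: "X \<in> borel_measurable M"
    using X l by (simp add: exponential_distributed_iff)
  have "prob {\<omega> \<in> space M. X \<omega> \<le> 0} = 0"
    using exponential_distributedD_le[OF X order_refl l] by simp
  then have "AE \<omega> in M. \<not> X \<omega> \<le> 0" by (subst (asm) prob_eq_0) auto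
  then show ?thesis by (simp add: not_le)
qed

text \<open>For \<open>T \<le> 0\<close> both inequalities hold almost surely. For
  \<open>T > 0\<close> first average over \<open>G\<close> with \<open>R = r\<close> frozen, which
  gives \<open>1 - exp (- (n * r))\<close>, and then integrate against the density of
  \<open>R\<close> over \<open>r \<ge> T / c\<close>.\<close>

lemma (in prob_space) relay_link_success_prob:
  assumes R: "distributed M lborel R (exponential_density lrd)" and lrd: "0 < lrd"
    and G: "distributed M lborel G (exponential_density lrp)" and lrp: "0 < lrp"
    and RG: "indep_var borel R borel G"
    and c: "0 < c" and x: "0 < x"
  shows "prob {\<omega> \<in> space M. T \<le> c * R \<omega> \<and> T * G \<omega> \<le> x * R \<omega>} = link_prob (lrd * T / c) (lrp * x / c)"
proof -
  have [measurable]: "R \<in> borel_measurable M" "G \<in> borel_measurable M"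
    using R lrd G lrp by (simp_all add: exponential_distributed_iff)
  have Rp: "AE \<omega> in M. 0 < R \<omega>" and Gp: "AE \<omega> in M. 0 < G \<omega>"
    using exponential_pos_AE[OF R lrd] exponential_pos_AE[OF G lrp] .
  show ?thesis
  proof (cases "T \<le> 0")
    case True
    have "AE \<omega> in M. T \<le> c * R \<omega> \<and> T * G \<omega> \<le> x * R \<omega>"
      using Rp Gp
    proof eventually_elim
      case (elim \<omega>)
      have "T * G \<omega> \<le> 0" "0 \<le> x * R \<omega>" "0 \<le> c * R \<omega>"
        using elim True x c by (auto simp: mult_nonpos_nonneg)
      with True show ?case by linarith
    qed
    then have "prob {\<omega> \<in> space M. T \<le> c * R \<omega> \<and> T * G \<omega> \<le> x * R \<omega>} = 1"
      by (subst prob_Collect_eq_1) auto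
    moreover have "lrd * T / c \<le> 0" using True c lrd by (simp add: divide_le_0_iff mult_nonneg_nonpos)
    ultimately show ?thesis by (simp add: link_prob_def)
  next
    case False
    define n where "n = lrp * x / T"
    have n: "n > 0" using False lrp x by (simp add: n_def)
    have "emeasure M {\<omega> \<in> space M. T \<le> c * R \<omega> \<and> T * G \<omega> \<le> x * R \<omega>}
      = (\<integral>\<^sup>+\<omega>. indicator {(r, g). T \<le> c * r \<and> T * g \<le> x * r} (R \<omega>, G \<omega>) \<partial>M)"
    proof -
      have "emeasure M {\<omega> \<in> space M. T \<le> c * R \<omega> \<and> T * G \<omega> \<le> x * R \<omega>}
        = (\<integral>\<^sup>+\<omega>. indicator {\<omega> \<in> space M. T \<le> c * R \<omega> \<and> T * G \<omega> \<le> x * R \<omega>} \<omega> \<partial>M)"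
        by (rule nn_integral_indicator[symmetric]) measurable
      also have "\<dots> = (\<integral>\<^sup>+\<omega>. indicator {(r, g). T \<le> c * r \<and> T * g \<le> x * r} (R \<omega>, G \<omega>) \<partial>M)"
        by (intro nn_integral_cong) (simp split: split_indicator)
      finally show ?thesis .
    qed
    also have "\<dots> = (\<integral>\<^sup>+\<omega>. \<integral>\<^sup>+\<omega>'. indicator {(r, g). T \<le> c * r \<and> T * g \<le> x * r} (R \<omega>, G \<omega>') \<partial>M \<partial>M)"
      by (rule indep_var_nn_integral_decouple[OF RG]) measurable
    also have "\<dots> = (\<integral>\<^sup>+\<omega>. ennreal (1 - exp (- (n * R \<omega>))) * indicator {T / c..} (R \<omega>) \<partial>M)"
    proof (rule nn_integral_cong_AE, use Rp in eventually_elim)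
      case (elim \<omega>)
      have "(\<integral>\<^sup>+\<omega>'. indicator {(r, g). T \<le> c * r \<and> T * g \<le> x * r} (R \<omega>, G \<omega>') \<partial>M)
        = (\<integral>\<^sup>+\<omega>'. indicator {T / c..} (R \<omega>) * indicator {\<omega>' \<in> space M. G \<omega>' \<le> x * R \<omega> / T} \<omega>' \<partial>M)"
        using False c by (intro nn_integral_cong)
          (auto split: split_indicator simp: divide_simps mult.commute)
      also have "\<dots> = indicator {T / c..} (R \<omega>) * emeasure M {\<omega>' \<in> space M. G \<omega>' \<le> x * R \<omega> / T}"
        by (subst nn_integral_cmult_indicator) auto
      also have "emeasure M {\<omega>' \<in> space M. G \<omega>' \<le> x * R \<omega> / T} = ennreal (1 - exp (- (n * R \<omega>)))"
        using exponential_distributedD_le[OF G _ lrp, of "x * R \<omega> / T"] elim False x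
        by (simp add: emeasure_eq_measure n_def mult_ac)
      finally show ?case by (simp add: mult.commute)
    qed
    also have "\<dots> = (\<integral>\<^sup>+r. ennreal (exponential_density lrd r) * (ennreal (1 - exp (- (n * r))) * indicator {T / c..} r) \<partial>lborel)"
      by (rule distributed_nn_integral[OF R, symmetric]) measurable
    also have "\<dots> = (\<integral>\<^sup>+r. ennreal (lrd * exp (- (lrd * r)) * (1 - exp (- (n * r)))) * indicator {T / c..} r \<partial>lborel)"
    proof (intro nn_integral_cong)
      fix r :: real
      have "r \<ge> 0" if "T / c \<le> r" using False c that by (meson divide_nonneg_pos le_cases order_trans)
      then show "ennreal (exponential_density lrd r) * (ennreal (1 - exp (- (n * r))) * indicator {T / c..} r)
        = ennreal (lrd * exp (- (lrd * r)) * (1 - exp (- (n * r)))) * indicator {T / c..} r"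
        using lrd n by (auto split: split_indicator simp: exponential_density_def ennreal_mult'[symmetric] mult_ac)
    qed
    also have "\<dots> = 0 - (lrd / (lrd + n) * exp (- ((lrd + n) * (T / c))) - exp (- (lrd * (T / c))))"
    proof (rule nn_integral_FTC_atLeast)
      fix r assume r: "T / c \<le> r"
      have "((\<lambda>r. lrd / (lrd + n) * exp (- ((lrd + n) * r)) - exp (- (lrd * r)))
          has_real_derivative lrd / (lrd + n) * (exp (- ((lrd + n) * r)) * - (lrd + n))
            - exp (- (lrd * r)) * - lrd) (at r)"
        using lrd n by (intro derivative_eq_intros | simp)+
      also have "lrd / (lrd + n) * (exp (- ((lrd + n) * r)) * - (lrd + n)) - exp (- (lrd * r)) * - lrd
          = lrd * exp (- (lrd * r)) * (1 - exp (- (n * r)))"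
      proof -
        have e1: "lrd / (lrd + n) * (exp (- ((lrd + n) * r)) * - (lrd + n)) = - (lrd * exp (- ((lrd + n) * r)))"
          using lrd n by (simp add: divide_simps) (simp add: algebra_simps)
        have e2: "exp (- ((lrd + n) * r)) = exp (- (lrd * r)) * exp (- (n * r))"
          by (simp add: exp_add[symmetric] algebra_simps)
        have "- (lrd * (p * q)) - p * - lrd = lrd * p * (1 - q)" for p q by (simp add: algebra_simps)
        then show ?thesis unfolding e1 unfolding e2 .
      qed
      finally show "((\<lambda>r. lrd / (lrd + n) * exp (- ((lrd + n) * r)) - exp (- (lrd * r)))
          has_real_derivative lrd * exp (- (lrd * r)) * (1 - exp (- (n * r)))) (at r)" .
      have "r \<ge> 0" using False c r by (meson divide_nonneg_pos le_cases order_trans)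
      then show "0 \<le> lrd * exp (- (lrd * r)) * (1 - exp (- (n * r)))" using lrd n by simp
    next
      show "((\<lambda>r. lrd / (lrd + n) * exp (- ((lrd + n) * r)) - exp (- (lrd * r))) \<longlongrightarrow> 0) at_top"
      proof -
        have "((\<lambda>r. exp (- (m * r))) \<longlongrightarrow> 0) at_top" if "0 < m" for m :: real
          using that by real_asymp
        from tendsto_diff[OF tendsto_mult_right_zero[OF this] this, of "lrd + n" lrd "lrd / (lrd + n)"]
        show ?thesis using lrd n by simp
      qed
    qed measurable
    also have "\<dots> = link_prob (lrd * T / c) (lrp * x / c)"
    proof -
      have p: "\<not> lrd * T / c \<le> 0" using False lrd c by (simp add: divide_le_0_iff mult_le_0_iff)
      \<comment> \<open>Since \<open>n * (T / c) = lrp * x / c\<close>, the value of the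
        antiderivative at \<open>T / c\<close> is expressed by the two arguments of
        \<open>link_prob\<close>.\<close>
      have "lrd * T / c / (lrd * T / c + lrp * x / c) = lrd / (lrd + n)"
        using False c lrd lrp x by (simp add: n_def divide_simps)
      moreover have "exp (- ((lrd + n) * (T / c))) = exp (- (lrd * T / c)) * exp (- (lrp * x / c))"
        using False by (simp add: n_def exp_add[symmetric] ring_distribs add_divide_distrib)
      ultimately show ?thesis using p by (simp add: link_prob_def algebra_simps)
    qed
    finally show ?thesis using link_prob_nonneg[of "lrp * x / c"] lrp x c
      by (simp add: emeasure_eq_measure)
  qed
qed

section \<open>The fading channel in terms of its power gains\<close>

locale fading_channel = prob_space M for M :: "'w measure" +
  fixes W :: "link \<Rightarrow> 'w \<Rightarrow> real" and L :: nat
    and lam_sr lam_rd lam_sd lam_sp lam_rp :: real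
  assumes L: "1 \<le> L"
    and lam: "0 < lam_sr" "0 < lam_rd" "0 < lam_sd" "0 < lam_sp" "0 < lam_rp"
    and W_exponential: "\<And>c. c \<in> links L \<Longrightarrow> distributed M lborel (W c)
      (exponential_density (link_rate lam_sr lam_rd lam_sd lam_sp lam_rp c))"
    and W_indep: "indep_vars (\<lambda>_. borel) W (links L)"
    and W_nonneg: "\<And>c \<omega>. 0 \<le> W c \<omega>"
begin

lemma in_links [simp]:
  "SD \<in> links L" "SP \<in> links L"
  "i \<in> {1..L} \<Longrightarrow> SR i \<in> links L" "i \<in> {1..L} \<Longrightarrow> RD i \<in> links L" "i \<in> {1..L} \<Longrightarrow> RP i \<in> links L"
  by (auto simp: links_def)

lemma W_measurable: "c \<in> links L \<Longrightarrow> W c \<in> borel_measurable M"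
  using distributed_measurable[OF W_exponential] by simp

lemma link_rate_pos: "0 < link_rate lam_sr lam_rd lam_sd lam_sp lam_rp c"
  using lam by (cases c) auto

lemma W_pos_AE: "c \<in> links L \<Longrightarrow> AE \<omega> in M. 0 < W c \<omega>"
  using exponential_pos_AE[OF W_exponential link_rate_pos] .

definition S :: "'w \<Rightarrow> real" where "S \<omega> = (\<Sum>i\<in>{1..L}. W (SR i) \<omega>)"

lemma S_pos_AE: "AE \<omega> in M. 0 < S \<omega>"
proof -
  have "AE \<omega> in M. 0 < W (SR 1) \<omega>" using L by (intro W_pos_AE) simp
  then show ?thesis
  proof eventually_elim
    case (elim \<omega>)
    have "W (SR 1) \<omega> \<le> S \<omega>"
      unfolding S_def using L W_nonneg by (intro member_le_sum) auto
    with elim show ?case by simp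
  qed
qed

text \<open>A predicate on gain vectors instead of outcomes, so that the relay gains can come from a
  second outcome while \<open>T\<close>, \<open>c\<close> and \<open>x\<close> stay frozen. Clearing
  denominators avoids division by a gain that may vanish.\<close>

definition relayed :: "real \<Rightarrow> real \<Rightarrow> real \<Rightarrow> (link \<Rightarrow> real) \<Rightarrow> bool" where
  "relayed T c x v \<longleftrightarrow> (\<exists>j\<in>{1..L}. T \<le> c * v (RD j) \<and> T * v (RP j) \<le> x * v (RD j))"

lemma indep_pair: assumes "a \<in> links L" "b \<in> links L" "a \<noteq> b"
  shows "indep_var borel (W a) borel (W b)"
proof -
  have "indep_var borel ((\<lambda>f. f a) \<circ> (\<lambda>\<omega>. restrict (\<lambda>i. W i \<omega>) {a}))
      borel ((\<lambda>f. f b) \<circ> (\<lambda>\<omega>. restrict (\<lambda>i. W i \<omega>) {b}))"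
    using assms by (intro indep_var_compose[OF indep_var_restrict[OF W_indep]]) auto
  then show ?thesis by (simp add: comp_def)
qed

text \<open>The pairs \<open>K j\<close> of links at different antennas are disjoint, so the
  failures \<open>P j\<close> are independent with common probability \<open>1 - ?q\<close>;
  relaying fails exactly when all \<open>L\<close> antennas fail.\<close>

lemma relayed_prob:
  assumes c: "0 < c" and x: "0 < x"
  shows "{\<omega> \<in> space M. relayed T c x (\<lambda>i. W i \<omega>)} \<in> events"
    and "prob {\<omega> \<in> space M. relayed T c x (\<lambda>i. W i \<omega>)} = 1 - (1 - link_prob (lam_rd * T / c) (lam_rp * x / c)) ^ L"
proof -
  let ?q = "link_prob (lam_rd * T / c) (lam_rp * x / c)"
  define K where "K = (\<lambda>j. {RD j, RP j})"
  define P where "P = (\<lambda>j v. \<not> (T \<le> c * v (RD j) \<and> T * v (RP j) \<le> x * v (RD j)))"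
  have iv: "indep_vars (\<lambda>j. PiM (K j) (\<lambda>_. borel)) (\<lambda>j \<omega>. restrict (\<lambda>i. W i \<omega>) (K j)) {1..L}"
    by (rule indep_vars_restrict[OF W_indep]) (auto simp: K_def disjoint_family_on_def)
  have "indep_events (\<lambda>j. {\<omega> \<in> space M. P j (restrict (\<lambda>i. W i \<omega>) (K j))}) {1..L}"
  proof (rule indep_eventsI_indep_vars[OF iv])
    fix j
    have comp: "(\<lambda>v. v (RD j)) \<in> borel_measurable (PiM (K j) (\<lambda>_. borel :: real measure))"
      "(\<lambda>v. v (RP j)) \<in> borel_measurable (PiM (K j) (\<lambda>_. borel :: real measure))"
      by (rule measurable_component_singleton, simp add: K_def)+
    show "{v \<in> space (PiM (K j) (\<lambda>_. borel)). P j v} \<in> sets (PiM (K j) (\<lambda>_. borel))"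
      unfolding P_def
      by (intro sets.sets_Collect_neg sets.sets_Collect_conj borel_measurable_le borel_measurable_times
          borel_measurable_const comp)
  qed
  then have ind: "indep_events (\<lambda>j. {\<omega> \<in> space M. P j (\<lambda>i. W i \<omega>)}) {1..L}"
    by (simp add: P_def K_def)
  have ev: "{\<omega> \<in> space M. P j (\<lambda>i. W i \<omega>)} \<in> events" if "j \<in> {1..L}" for j
    using ind that by (auto simp: indep_events_def)
  have pr: "prob {\<omega> \<in> space M. P j (\<lambda>i. W i \<omega>)} = 1 - ?q" if j: "j \<in> {1..L}" for j
  proof -
    have [measurable]: "W (RD j) \<in> borel_measurable M" "W (RP j) \<in> borel_measurable M"
      using j by (auto intro!: W_measurable)
    have "prob {\<omega> \<in> space M. T \<le> c * W (RD j) \<omega> \<and> T * W (RP j) \<omega> \<le> x * W (RD j) \<omega>} = ?q"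
      using j lam c x W_exponential[of "RD j"] W_exponential[of "RP j"]
      by (intro relay_link_success_prob indep_pair) auto
    moreover have "{\<omega> \<in> space M. T \<le> c * W (RD j) \<omega> \<and> T * W (RP j) \<omega> \<le> x * W (RD j) \<omega>} \<in> events"
      by measurable
    ultimately show ?thesis unfolding P_def by (simp only: prob_neg)
  qed
  have eq: "{\<omega> \<in> space M. relayed T c x (\<lambda>i. W i \<omega>)} = space M - (\<Inter>j\<in>{1..L}. {\<omega> \<in> space M. P j (\<lambda>i. W i \<omega>)})"
    using L by (auto simp: relayed_def P_def)
  have int: "(\<Inter>j\<in>{1..L}. {\<omega> \<in> space M. P j (\<lambda>i. W i \<omega>)}) \<in> events"
    using L ev by (intro sets.finite_INT) auto
  then show "{\<omega> \<in> space M. relayed T c x (\<lambda>i. W i \<omega>)} \<in> events" unfolding eq by auto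
  have "prob (\<Inter>j\<in>{1..L}. {\<omega> \<in> space M. P j (\<lambda>i. W i \<omega>)}) = (\<Prod>j\<in>{1..L}. prob {\<omega> \<in> space M. P j (\<lambda>i. W i \<omega>)})"
    using ind L by (simp add: indep_events_def)
  also have "\<dots> = (1 - ?q) ^ L" using pr by simp
  finally show "prob {\<omega> \<in> space M. relayed T c x (\<lambda>i. W i \<omega>)} = 1 - (1 - ?q) ^ L"
    unfolding eq using int by (simp add: prob_compl)
qed

definition success :: "real \<Rightarrow> real \<Rightarrow> real \<Rightarrow> 'w \<Rightarrow> bool" where
  "success a xi be \<omega> \<longleftrightarrow> a * W SP \<omega> \<le> xi * S \<omega> \<and>
    relayed (a * W SP \<omega> - W SD \<omega>) (be * S \<omega>) (W SP \<omega>) (\<lambda>i. W i \<omega>)"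

definition source_links :: "link set" where "source_links = SR ` {1..L} \<union> {SD, SP}"
definition relay_links :: "link set" where "relay_links = RD ` {1..L} \<union> RP ` {1..L}"

lemma S_measurable [measurable]: "S \<in> borel_measurable M"
  unfolding S_def by (intro borel_measurable_sum W_measurable) simp

lemma W_measurable' [measurable]: "W SD \<in> borel_measurable M" "W SP \<in> borel_measurable M"
  by (simp_all add: W_measurable)

lemma success_event: "{\<omega> \<in> space M. success a xi be \<omega>} \<in> events"
proof -
  have [measurable]: "Measurable.pred M (\<lambda>\<omega>. relayed (a * W SP \<omega> - W SD \<omega>) (be * S \<omega>) (W SP \<omega>) (\<lambda>i. W i \<omega>))"
    unfolding relayed_def
  proof (rule pred_intros_finite)
    fix j assume "j \<in> {1..L}"
    then have [measurable]: "W (RD j) \<in> borel_measurable M" "W (RP j) \<in> borel_measurable M"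
      by (auto intro!: W_measurable)
    show "Measurable.pred M (\<lambda>\<omega>. a * W SP \<omega> - W SD \<omega> \<le> be * S \<omega> * W (RD j) \<omega> \<and>
      (a * W SP \<omega> - W SD \<omega>) * W (RP j) \<omega> \<le> W SP \<omega> * W (RD j) \<omega>)" by measurable
  qed simp
  show ?thesis unfolding success_def by measurable
qed

text \<open>Two decouplings. Averaging over the relay links with the source links frozen turns the
  event into \<open>cond_success\<close>. Then \<open>SP\<close> is separated from the remaining
  source links, which leaves an inner integral over its exponential law, the one that supplies
  concavity.\<close>

lemma success_prob:
  assumes a: "0 < a" and be: "0 < be" and xi: "0 \<le> xi"
  defines "D \<equiv> density lborel (exponential_density lam_sp)"
  shows "emeasure M {\<omega> \<in> space M. success a xi be \<omega>} =
    (\<integral>\<^sup>+\<omega>. \<integral>\<^sup>+x. cond_success L a lam_rd lam_rp (S \<omega>) (W SD \<omega>) xi be x \<partial>D \<partial>M)"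
proof -
  let ?suc = "cond_success L a lam_rd lam_rp"
  let ?P = "\<lambda>I. PiM I (\<lambda>_. borel :: real measure)"
  let ?R = "\<lambda>I \<omega>. restrict (\<lambda>i. W i \<omega>) I"
  let ?S = "\<lambda>u. \<Sum>i\<in>{1..L}. u (SR i) :: real"
  have SR: "(\<lambda>u. ?S u) \<in> borel_measurable (?P I)" if "SR ` {1..L} \<subseteq> I" for I
    using that by (intro borel_measurable_sum measurable_component_singleton) auto
  have [measurable]: "(\<lambda>u. ?S u) \<in> borel_measurable (?P source_links)"
    by (rule SR) (auto simp: source_links_def)
  have [simp]: "SD \<in> source_links" "SP \<in> source_links"
    "j \<in> {1..L} \<Longrightarrow> RD j \<in> relay_links" "j \<in> {1..L} \<Longrightarrow> RP j \<in> relay_links" for j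
    by (auto simp: source_links_def relay_links_def)
  define F :: "(link \<Rightarrow> real) \<times> (link \<Rightarrow> real) \<Rightarrow> ennreal" where
    "F = (\<lambda>(u, v). indicator {True} (a * u SP \<le> xi * ?S u \<and> relayed (a * u SP - u SD) (be * ?S u) (u SP) v))"
  have F: "F \<in> borel_measurable (?P source_links \<Otimes>\<^sub>M ?P relay_links)"
  proof -
    have [measurable]: "Measurable.pred (?P source_links \<Otimes>\<^sub>M ?P relay_links)
      (\<lambda>z. relayed (a * fst z SP - fst z SD) (be * ?S (fst z)) (fst z SP) (snd z))"
      unfolding relayed_def
    proof (rule pred_intros_finite)
      fix j assume j: "j \<in> {1..L}"
      have comp: "(\<lambda>z. fst z c) \<in> borel_measurable (?P source_links \<Otimes>\<^sub>M ?P relay_links)"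
        if "c \<in> source_links" for c
        using that by (intro measurable_compose[OF measurable_fst measurable_component_singleton])
      have comp': "(\<lambda>z. snd z c) \<in> borel_measurable (?P source_links \<Otimes>\<^sub>M ?P relay_links)"
        if "c \<in> relay_links" for c
        using that by (intro measurable_compose[OF measurable_snd measurable_component_singleton])
      have compS: "(\<lambda>z. ?S (fst z)) \<in> borel_measurable (?P source_links \<Otimes>\<^sub>M ?P relay_links)"
        by measurable
      show "Measurable.pred (?P source_links \<Otimes>\<^sub>M ?P relay_links)
        (\<lambda>z. a * fst z SP - fst z SD \<le> be * ?S (fst z) * snd z (RD j) \<and>
          (a * fst z SP - fst z SD) * snd z (RP j) \<le> fst z SP * snd z (RD j))"
        unfolding pred_def
        by (intro sets.sets_Collect_conj borel_measurable_le borel_measurable_times borel_measurable_diff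
            borel_measurable_const comp comp' compS) (use j in simp_all)
    qed simp
    show ?thesis unfolding F_def split_beta by measurable
  qed
  have Rs: "?S (?R source_links \<omega>) = S \<omega>" "?S (?R (SR ` {1..L} \<union> {SD}) \<omega>) = S \<omega>" for \<omega>
    by (simp_all add: S_def source_links_def)
  have rel: "relayed T c x (?R relay_links \<omega>) \<longleftrightarrow> relayed T c x (\<lambda>i. W i \<omega>)" for T c x \<omega>
    by (auto simp: relayed_def)
  have F_eq: "F (?R source_links \<omega>, ?R relay_links \<omega>') = indicator {True}
      (a * W SP \<omega> \<le> xi * S \<omega> \<and> relayed (a * W SP \<omega> - W SD \<omega>) (be * S \<omega>) (W SP \<omega>) (\<lambda>i. W i \<omega>'))"
    for \<omega> \<omega>'
    unfolding F_def prod.case Rs rel by simp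
  have "emeasure M {\<omega> \<in> space M. success a xi be \<omega>}
      = (\<integral>\<^sup>+\<omega>. indicator {\<omega> \<in> space M. success a xi be \<omega>} \<omega> \<partial>M)"
    by (rule nn_integral_indicator[symmetric, OF success_event])
  also have "\<dots> = (\<integral>\<^sup>+\<omega>. F (?R source_links \<omega>, ?R relay_links \<omega>) \<partial>M)"
    by (intro nn_integral_cong) (simp add: F_eq success_def split: split_indicator)
  also have "\<dots> = (\<integral>\<^sup>+\<omega>. \<integral>\<^sup>+\<omega>'. F (?R source_links \<omega>, ?R relay_links \<omega>') \<partial>M \<partial>M)"
    by (rule indep_var_nn_integral_decouple[OF indep_var_restrict[OF W_indep] F])
       (auto simp: source_links_def relay_links_def)
  also have "\<dots> = (\<integral>\<^sup>+\<omega>. ?suc (S \<omega>) (W SD \<omega>) xi be (W SP \<omega>) \<partial>M)"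
  proof (rule nn_integral_cong_AE)
    \<comment> \<open>The formula for the relay links requires \<open>0 < be * S \<omega>\<close>
      and \<open>0 < W SP \<omega>\<close>, which hold only almost everywhere.\<close>
    have "AE \<omega> in M. 0 < W SP \<omega>" by (rule W_pos_AE) simp
    with S_pos_AE show "AE \<omega> in M. (\<integral>\<^sup>+\<omega>'. F (?R source_links \<omega>, ?R relay_links \<omega>') \<partial>M) = ennreal (?suc (S \<omega>) (W SD \<omega>) xi be (W SP \<omega>))"
    proof eventually_elim
      case (elim \<omega>)
      let ?A = "{\<omega>' \<in> space M. relayed (a * W SP \<omega> - W SD \<omega>) (be * S \<omega>) (W SP \<omega>) (\<lambda>i. W i \<omega>')}"
      have bs: "0 < be * S \<omega>" using be elim by simp
      show ?case
      proof (cases "a * W SP \<omega> \<le> xi * S \<omega>")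
        case True
        have "(\<integral>\<^sup>+\<omega>'. F (?R source_links \<omega>, ?R relay_links \<omega>') \<partial>M) = (\<integral>\<^sup>+\<omega>'. indicator ?A \<omega>' \<partial>M)"
          using True by (intro nn_integral_cong) (simp add: F_eq split: split_indicator)
        also have "\<dots> = emeasure M ?A"
          by (rule nn_integral_indicator[OF relayed_prob(1)[OF bs elim(2)]])
        also have "\<dots> = ?suc (S \<omega>) (W SD \<omega>) xi be (W SP \<omega>)"
          using True relayed_prob(2)[OF bs elim(2)] by (simp add: emeasure_eq_measure cond_success_def)
        finally show ?thesis .
      next
        case False
        then show ?thesis by (simp add: F_eq cond_success_def)
      qed
    qed
  qed
  also have "\<dots> = (\<integral>\<^sup>+\<omega>. (\<lambda>(u, v). ennreal (?suc (?S u) (u SD) xi be (v SP)))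
      (?R (SR ` {1..L} \<union> {SD}) \<omega>, ?R {SP} \<omega>) \<partial>M)"
    unfolding prod.case Rs by simp
  also have "\<dots> = (\<integral>\<^sup>+\<omega>. \<integral>\<^sup>+\<omega>'. (\<lambda>(u, v). ennreal (?suc (?S u) (u SD) xi be (v SP)))
      (?R (SR ` {1..L} \<union> {SD}) \<omega>, ?R {SP} \<omega>') \<partial>M \<partial>M)"
  proof (rule indep_var_nn_integral_decouple[OF indep_var_restrict[OF W_indep]])
    have [measurable]: "(\<lambda>u. ?S u) \<in> borel_measurable (?P (SR ` {1..L} \<union> {SD}))"
      by (rule SR) auto
    have [simp]: "SD \<in> SR ` {1..L} \<union> {SD}" "SP \<in> {SP}" by auto
    show "(\<lambda>(u, v). ennreal (?suc (?S u) (u SD) xi be (v SP)))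
      \<in> borel_measurable (?P (SR ` {1..L} \<union> {SD}) \<Otimes>\<^sub>M ?P {SP})"
      unfolding cond_success_def link_prob_def split_beta by measurable
  qed auto
  also have "\<dots> = (\<integral>\<^sup>+\<omega>. \<integral>\<^sup>+x. ?suc (S \<omega>) (W SD \<omega>) xi be x \<partial>D \<partial>M)"
  proof (intro nn_integral_cong)
    fix \<omega>
    have D: "D = distr M lborel (W SP)"
      using distributed_distr_eq_density[OF W_exponential[of SP]] by (simp add: D_def)
    show "(\<integral>\<^sup>+\<omega>'. (\<lambda>(u, v). ennreal (?suc (?S u) (u SD) xi be (v SP)))
      (?R (SR ` {1..L} \<union> {SD}) \<omega>, ?R {SP} \<omega>') \<partial>M) = (\<integral>\<^sup>+x. ?suc (S \<omega>) (W SD \<omega>) xi be x \<partial>D)"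
      unfolding D prod.case Rs 
      by (subst nn_integral_distr) (auto intro!: measurable_compose[OF cond_success_measurable measurable_ennreal])
  qed
  finally show ?thesis .
qed

text \<open>Joint concavity in \<open>(xi, be)\<close>: it holds for the inner integral at almost
  every frozen outcome, and averaging over outcomes preserves it.\<close>

lemma success_prob_concave:
  assumes a: "0 < a" and be: "0 < be1" "0 < be2" and xi: "0 \<le> xi1" "0 \<le> xi2" and t: "0 \<le> t" "t \<le> 1"
  shows "(1 - t) * prob {\<omega> \<in> space M. success a xi1 be1 \<omega>} + t * prob {\<omega> \<in> space M. success a xi2 be2 \<omega>}
    \<le> prob {\<omega> \<in> space M. success a ((1 - t) * xi1 + t * xi2) ((1 - t) * be1 + t * be2) \<omega>}"
proof -
  define D where "D = density lborel (exponential_density lam_sp)"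
  define I where "I = (\<lambda>xi be \<omega>. \<integral>\<^sup>+x. cond_success L a lam_rd lam_rp (S \<omega>) (W SD \<omega>) xi be x \<partial>D)"
  have be3: "0 < (1 - t) * be1 + t * be2" using be t by (rule convex_combination_pos)
  have xi3: "0 \<le> (1 - t) * xi1 + t * xi2" using xi t by simp
  interpret D: prob_space D unfolding D_def using lam by (intro prob_space_exponential_density)
  have [measurable_cong]: "sets D = sets borel" by (simp add: D_def)
  have I[measurable]: "I xi be \<in> borel_measurable M" for xi be
    unfolding I_def cond_success_def link_prob_def by measurable
  have P: "ennreal (prob {\<omega> \<in> space M. success a xi be \<omega>}) = (\<integral>\<^sup>+\<omega>. I xi be \<omega> \<partial>M)"
    if "0 < be" "0 \<le> xi" for xi be
    using success_prob[OF a that] by (simp add: emeasure_eq_measure I_def D_def)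
  have "ennreal ((1 - t) * prob {\<omega> \<in> space M. success a xi1 be1 \<omega>} + t * prob {\<omega> \<in> space M. success a xi2 be2 \<omega>})
    = ennreal (1 - t) * (\<integral>\<^sup>+\<omega>. I xi1 be1 \<omega> \<partial>M) + ennreal t * (\<integral>\<^sup>+\<omega>. I xi2 be2 \<omega> \<partial>M)"
    using t be xi by (simp add: ennreal_plus ennreal_mult P[symmetric])
  also have "\<dots> = (\<integral>\<^sup>+\<omega>. ennreal (1 - t) * I xi1 be1 \<omega> + ennreal t * I xi2 be2 \<omega> \<partial>M)"
    by (simp add: nn_integral_add nn_integral_cmult)
  also have "\<dots> \<le> (\<integral>\<^sup>+\<omega>. I ((1 - t) * xi1 + t * xi2) ((1 - t) * be1 + t * be2) \<omega> \<partial>M)"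
  proof (rule nn_integral_mono_AE, use S_pos_AE in eventually_elim)
    case (elim \<omega>)
    then show ?case unfolding I_def D_def
      using cond_success_integral_concave[OF L a lam(2) lam(5) elim W_nonneg be xi t lam(4)] by simp
  qed
  also have "\<dots> = ennreal (prob {\<omega> \<in> space M. success a ((1 - t) * xi1 + t * xi2) ((1 - t) * be1 + t * be2) \<omega>})"
    by (rule P[symmetric, OF be3 xi3])
  finally show ?thesis by (simp add: ennreal_le_iff)
qed

end

section \<open>The protocols\<close>

lemma arg_max_on_finite:
  fixes f :: "'a \<Rightarrow> 'b :: linorder"
  assumes "finite A" "A \<noteq> {}"
  shows "arg_max_on f A \<in> A" and "x \<in> A \<Longrightarrow> f x \<le> f (arg_max_on f A)"
proof -
  have "Max (f ` A) \<in> f ` A" using assms by simp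
  then obtain m where "m \<in> A" "f m = Max (f ` A)" by auto
  then have "is_arg_max f (\<lambda>x. x \<in> A) m" using assms by (simp add: is_arg_max_linorder)
  then have "is_arg_max f (\<lambda>x. x \<in> A) (arg_max_on f A)"
    unfolding arg_max_on_def arg_max_def by (rule someI)
  then show "arg_max_on f A \<in> A" "x \<in> A \<Longrightarrow> f x \<le> f (arg_max_on f A)"
    by (auto simp: is_arg_max_linorder)
qed

lemma snr_selected_ge_iff:
  assumes "1 \<le> L"
  shows "\<theta> \<le> snr_dest L h Ip No \<eta> prot \<rho> (selected_antenna L h Ip No \<eta> prot \<rho> \<omega>) \<omega>
    \<longleftrightarrow> (\<exists>j\<in>{1..L}. \<theta> \<le> snr_dest L h Ip No \<eta> prot \<rho> j \<omega>)"
  unfolding selected_antenna_def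
  using arg_max_on_finite[where A = "{1..L}" and f = "\<lambda>j. snr_dest L h Ip No \<eta> prot \<rho> j \<omega>"] assms
  by (auto intro: order_trans)

lemma relay_snr_ge_iff:
  fixes xi s x Ip No \<theta> :: real
  assumes "0 < x" "0 < Ip" "0 < No"
  shows "\<theta> \<le> xi * (Ip / x) * s / No \<longleftrightarrow> \<theta> * No / Ip * x \<le> xi * s"
  using assms by (simp add: field_simps)

text \<open>The minimum dominates a bound exactly when both of its members do. With
  \<open>a = \<theta> * No / Ip\<close>, the first inequality loses the positive factor
  \<open>Ip / x\<close> and the second \<open>Ip / (x * g)\<close>.\<close>

lemma dest_snr_ge_iff:
  fixes be s x y r g Ip No \<theta> :: real
  assumes "0 < x" "0 < g" "0 \<le> r" "0 < Ip" "0 < No"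
  shows "\<theta> \<le> 1 / No * min (be * (Ip / x) * s) (Ip / g) * r + Ip / x * y / No \<longleftrightarrow>
    \<theta> * No / Ip * x - y \<le> be * s * r \<and> (\<theta> * No / Ip * x - y) * g \<le> x * r"
proof -
  define a where "a = \<theta> * No / Ip"
  have \<theta>: "\<theta> = a * Ip / No" using assms by (simp add: a_def)
  have "1 / No * min (be * (Ip / x) * s) (Ip / g) * r + Ip / x * y / No
      = min (be * (Ip / x) * s * r) (Ip / g * r) / No + Ip / x * y / No"
    using assms by (simp add: min_mult_distrib_right)
  also have "\<theta> \<le> \<dots> \<longleftrightarrow> a * Ip - Ip / x * y \<le> be * (Ip / x) * s * r \<and> a * Ip - Ip / x * y \<le> Ip / g * r"
  proof -
    have "a * Ip / No \<le> m / No + b / No \<longleftrightarrow> a * Ip - b \<le> m" for m b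
      using assms by (auto simp: add_divide_distrib[symmetric] divide_le_cancel)
    then show ?thesis unfolding \<theta> by (simp only: min.bounded_iff)
  qed
  also have "a * Ip - Ip / x * y \<le> be * (Ip / x) * s * r \<longleftrightarrow> a * x - y \<le> be * s * r"
  proof -
    have "a * Ip - Ip / x * y = Ip / x * (a * x - y)" "be * (Ip / x) * s * r = Ip / x * (be * s * r)"
      using assms by (simp_all add: right_diff_distrib)
    moreover have "0 < Ip / x" using assms by simp
    ultimately show ?thesis by (simp only: mult_le_cancel_left_pos)
  qed
  also have "a * Ip - Ip / x * y \<le> Ip / g * r \<longleftrightarrow> (a * x - y) * g \<le> x * r"
  proof -
    have "a * Ip - Ip / x * y = Ip / (x * g) * ((a * x - y) * g)" "Ip / g * r = Ip / (x * g) * (x * r)"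
      using assms by (simp_all add: field_simps)
    moreover have "0 < Ip / (x * g)" using assms by simp
    ultimately show ?thesis by (simp only: mult_le_cancel_left_pos)
  qed
  finally show ?thesis unfolding a_def .
qed

text \<open>The fractional linear map inside \<open>J\<close> sends a mixture to a mixture with new
  weights \<open>p\<close> and \<open>q\<close>, proportional to \<open>u * (1 - x)\<close> and
  \<open>v * (1 - y)\<close>. The factor \<open>1 - z\<close> in front undoes the normalization of
  these weights.\<close>

lemma concave_on_perspective:
  fixes J :: "real \<Rightarrow> real"
  assumes J: "concave_on {0<..} J" and k: "0 < k"
  shows "concave_on {0<..<1} (\<lambda>\<rho>. (1 - \<rho>) * J (k * \<rho> / (1 - \<rho>)))"
  unfolding concave_on_iff
proof (intro conjI ballI allI impI)
  fix x y u v :: real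
  assume xy: "x \<in> {0<..<1}" "y \<in> {0<..<1}" and uv: "0 \<le> u" "0 \<le> v" "u + v = 1"
  define z where "z = u * x + v * y"
  have w: "1 - z = u * (1 - x) + v * (1 - y)" using uv by (simp add: z_def algebra_simps)
  have "z \<in> {0<..<1}"
    using convexD[of "{0<..<1 :: real}" x y u v] xy uv by (simp add: z_def)
  then have z: "0 < z" "z < 1" by auto
  define p q where "p = u * (1 - x) / (1 - z)" and "q = v * (1 - y) / (1 - z)"
  have pq: "0 \<le> p" "0 \<le> q" "p + q = 1"
    using xy uv z w by (auto simp: p_def q_def add_divide_distrib[symmetric])
  have k': "p * (k * x / (1 - x)) + q * (k * y / (1 - y)) = k * z / (1 - z)"
  proof -
    have "p * (k * x / (1 - x)) = k * (u * x) / (1 - z)" "q * (k * y / (1 - y)) = k * (v * y) / (1 - z)"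
      using xy by (simp_all add: p_def q_def)
    then show ?thesis by (simp add: z_def add_divide_distrib[symmetric] distrib_left)
  qed
  have "k * x / (1 - x) \<in> {0<..}" "k * y / (1 - y) \<in> {0<..}" using xy k by auto
  then have "p * J (k * x / (1 - x)) + q * J (k * y / (1 - y)) \<le> J (k * z / (1 - z))"
    using J pq unfolding concave_on_iff k'[symmetric] real_scaleR_def by blast
  then have "(1 - z) * (p * J (k * x / (1 - x)) + q * J (k * y / (1 - y))) \<le> (1 - z) * J (k * z / (1 - z))"
    using z by (intro mult_left_mono) auto
  also have "(1 - z) * (p * J (k * x / (1 - x)) + q * J (k * y / (1 - y)))
      = u * ((1 - x) * J (k * x / (1 - x))) + v * ((1 - y) * J (k * y / (1 - y)))"
    using z by (simp add: p_def q_def distrib_left)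
  finally show "u * ((1 - x) * J (k * x / (1 - x))) + v * ((1 - y) * J (k * y / (1 - y)))
    \<le> (1 - (u *\<^sub>R x + v *\<^sub>R y)) * J (k * (u *\<^sub>R x + v *\<^sub>R y) / (1 - (u *\<^sub>R x + v *\<^sub>R y)))"
    by (simp add: z_def)
qed simp

theorem lemmaV1:
  fixes M :: "'w measure" and h :: "link \<Rightarrow> 'w \<Rightarrow> complex" and L :: nat
    and lam_sr lam_rd lam_sd lam_sp lam_rp Ip No \<eta> Rs :: real
  assumes "prob_space M"
    and "L \<ge> 1"
    and "lam_sr > 0" "lam_rd > 0" "lam_sd > 0" "lam_sp > 0" "lam_rp > 0"
    and "\<And>c. c \<in> links L \<Longrightarrow>
           circular_gaussian M (h c) (inverse (link_rate lam_sr lam_rd lam_sd lam_sp lam_rp c))"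
    and "prob_space.indep_vars M (\<lambda>_. borel) h (links L)"
    and "Ip > 0" "No > 0" "0 < \<eta>" "\<eta> \<le> 1" "Rs > 0"
  shows "concave_on {0<..<1} (throughput M L h Ip No \<eta> Rs PS_EH)
       \<and> concave_on {0<..<1} (throughput M L h Ip No \<eta> Rs TS_EH)"
proof -
  interpret prob_space M by fact
  define W where "W = (\<lambda>c \<omega>. (cmod (h c \<omega>))\<^sup>2)"
  interpret fading_channel M W L lam_sr lam_rd lam_sd lam_sp lam_rp
  proof
    show "indep_vars (\<lambda>_. borel) W (links L)"
      unfolding W_def by (rule indep_vars_compose2[OF assms(9)]) measurable
    fix c assume c: "c \<in> links L"
    have "0 < link_rate lam_sr lam_rd lam_sd lam_sp lam_rp c" using assms by (cases c) auto
    then show "distributed M lborel (W c) (exponential_density (link_rate lam_sr lam_rd lam_sd lam_sp lam_rp c))"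
      using circular_gaussian_norm_square_exponential[OF assms(8)[OF c]] by (simp add: W_def)
  qed (use assms in \<open>auto simp: W_def\<close>)
  define a where "a = threshold Rs * No / Ip"
  have "1 < 2 powr (2 * Rs)" using assms by simp
  then have a: "0 < a" using assms by (simp add: a_def threshold_def)
  \<comment> \<open>Success of the system and the event \<open>success\<close> differ by a null set;
    this holds for every real \<open>\<rho>\<close>.\<close>
  have outage: "1 - outage_prob M L h Ip No \<eta> Rs prot \<rho> = prob {\<omega> \<in> space M. success a (\<xi> prot \<rho>) (\<beta> prot \<eta> \<rho>) \<omega>}"
    for prot \<rho>
  proof -
    have h_measurable[measurable]: "h c \<in> borel_measurable M" if "c \<in> links L" for c
      using distributed_measurable assms(8)[OF that] unfolding circular_gaussian_def by fastforce
    define G where "G = (\<lambda>\<omega>. threshold Rs \<le> snr_relay L h Ip No prot \<rho> \<omega> \<and>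
      (\<exists>j\<in>{1..L}. threshold Rs \<le> snr_dest L h Ip No \<eta> prot \<rho> j \<omega>))"
    have meas: "{\<omega> \<in> space M. G \<omega>} \<in> events"
    proof -
      have [measurable]: "sr_gain L h \<in> borel_measurable M" "source_power Ip h \<in> borel_measurable M"
        "snr_direct h Ip No \<in> borel_measurable M"
        unfolding sr_gain_def source_power_def snr_direct_def by measurable
      have [measurable]: "snr_dest L h Ip No \<eta> prot \<rho> j \<in> borel_measurable M" if "j \<in> {1..L}" for j
      proof -
        have [measurable]: "h (RP j) \<in> borel_measurable M" "h (RD j) \<in> borel_measurable M"
          using that by (auto intro: h_measurable)
        show ?thesis unfolding snr_dest_def by measurable
      qed
      have [measurable]: "Measurable.pred M (\<lambda>\<omega>. \<exists>j\<in>{1..L}. threshold Rs \<le> snr_dest L h Ip No \<eta> prot \<rho> j \<omega>)"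
        by (rule pred_intros_finite) measurable
      show ?thesis unfolding G_def snr_relay_def by measurable
    qed
    \<comment> \<open>On this set no denominator in the SNRs vanishes, so the default value of
      division by 0 does not intervene.\<close>
    have "AE \<omega> in M. \<forall>c\<in>links L. 0 < W c \<omega>"
      by (rule AE_finite_allI) (auto simp: links_def intro: W_pos_AE)
    then have AE: "AE \<omega> in M. G \<omega> \<longleftrightarrow> success a (\<xi> prot \<rho>) (\<beta> prot \<eta> \<rho>) \<omega>"
    proof eventually_elim
      case (elim \<omega>)
      have SP: "0 < W SP \<omega>" using elim by simp
      have gain: "sr_gain L h \<omega> = S \<omega>" unfolding sr_gain_def S_def by (simp add: W_def)
      have power: "source_power Ip h \<omega> = Ip / W SP \<omega>" by (simp add: source_power_def W_def)
      have "threshold Rs \<le> snr_relay L h Ip No prot \<rho> \<omega> \<longleftrightarrow> a * W SP \<omega> \<le> \<xi> prot \<rho> * S \<omega>"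
        unfolding snr_relay_def gain power a_def by (rule relay_snr_ge_iff) (use SP assms in auto)
      moreover have "threshold Rs \<le> snr_dest L h Ip No \<eta> prot \<rho> j \<omega> \<longleftrightarrow>
        a * W SP \<omega> - W SD \<omega> \<le> \<beta> prot \<eta> \<rho> * S \<omega> * W (RD j) \<omega> \<and>
        (a * W SP \<omega> - W SD \<omega>) * W (RP j) \<omega> \<le> W SP \<omega> * W (RD j) \<omega>" if "j \<in> {1..L}" for j
        unfolding snr_dest_def snr_direct_def gain power a_def W_def[symmetric]
        using dest_snr_ge_iff[of "W SP \<omega>" "W (RP j) \<omega>" "W (RD j) \<omega>" Ip No] elim that assms W_nonneg
        by (simp add: W_def)
      ultimately show ?case by (simp add: G_def success_def relayed_def)
    qed
    have "outage_prob M L h Ip No \<eta> Rs prot \<rho> = prob {\<omega> \<in> space M. \<not> G \<omega>}"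
      unfolding outage_prob_def G_def snr_selected_ge_iff[OF \<open>L \<ge> 1\<close>, symmetric]
      by (rule arg_cong[where f = prob]) (auto simp: min_less_iff_disj)
    also have "\<dots> = 1 - prob {\<omega> \<in> space M. G \<omega>}" by (rule prob_neg[OF meas])
    also have "prob {\<omega> \<in> space M. G \<omega>} = prob {\<omega> \<in> space M. success a (\<xi> prot \<rho>) (\<beta> prot \<eta> \<rho>) \<omega>}"
      by (rule prob_eq_AE[OF AE meas success_event])
    finally show ?thesis by simp
  qed
  define J where "J = (\<lambda>xi be. prob {\<omega> \<in> space M. success a xi be \<omega>})"
  have J: "u * J xi1 be1 + v * J xi2 be2 \<le> J (u * xi1 + v * xi2) (u * be1 + v * be2)"
    if "0 \<le> u" "0 \<le> v" "u + v = 1" "0 < be1" "0 < be2" "0 \<le> xi1" "0 \<le> xi2" for u v xi1 be1 xi2 be2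
  proof -
    have u: "u = 1 - v" using that by simp
    show ?thesis unfolding u J_def using that by (intro success_prob_concave a) auto
  qed
  have "concave_on {0<..<1} (\<lambda>\<rho>. Rs / 2 * J (1 - \<rho>) (\<eta> * \<rho>))"
  proof (rule concave_on_cmul)
    show "concave_on {0<..<1} (\<lambda>\<rho>. J (1 - \<rho>) (\<eta> * \<rho>))"
      unfolding concave_on_iff
    proof (intro conjI ballI allI impI)
      fix x y u v :: real
      assume xy: "x \<in> {0<..<1}" "y \<in> {0<..<1}" and uv: "0 \<le> u" "0 \<le> v" "u + v = 1"
      have "u * J (1 - x) (\<eta> * x) + v * J (1 - y) (\<eta> * y)
        \<le> J (u * (1 - x) + v * (1 - y)) (u * (\<eta> * x) + v * (\<eta> * y))"
        using xy uv assms by (intro J) auto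
      also have "u * (1 - x) + v * (1 - y) = 1 - (u *\<^sub>R x + v *\<^sub>R y)"
        using uv by (simp add: algebra_simps)
      also have "u * (\<eta> * x) + v * (\<eta> * y) = \<eta> * (u *\<^sub>R x + v *\<^sub>R y)"
        by (simp add: algebra_simps)
      finally show "u * J (1 - x) (\<eta> * x) + v * J (1 - y) (\<eta> * y)
        \<le> J (1 - (u *\<^sub>R x + v *\<^sub>R y)) (\<eta> * (u *\<^sub>R x + v *\<^sub>R y))" .
    qed simp
  qed (use assms in simp)
  moreover have "concave_on {0<..<1} (\<lambda>\<rho>. Rs / 2 * ((1 - \<rho>) * J 1 (2 * \<eta> * \<rho> / (1 - \<rho>))))"
  proof (rule concave_on_cmul)
    \<comment> \<open>Concavity is required on the whole half-line because
      \<open>2 * \<eta> * \<rho> / (1 - \<rho>)\<close> is unbounded as \<open>\<rho>\<close>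
      approaches 1.\<close>
    have "concave_on {0<..} (J 1)"
      unfolding concave_on_iff
    proof (intro conjI ballI allI impI)
      fix x y u v :: real
      assume xy: "x \<in> {0<..}" "y \<in> {0<..}" and uv: "0 \<le> u" "0 \<le> v" "u + v = 1"
      then show "u * J 1 x + v * J 1 y \<le> J 1 (u *\<^sub>R x + v *\<^sub>R y)"
        using J[of u v x y 1 1] by simp
    qed simp
    then show "concave_on {0<..<1} (\<lambda>\<rho>. (1 - \<rho>) * J 1 (2 * \<eta> * \<rho> / (1 - \<rho>)))"
      using assms by (intro concave_on_perspective) auto
  qed (use assms in simp)
  ultimately show ?thesis
    unfolding throughput_def outage J_def by (simp add: mult_ac)
qed

end
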